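(* Let $\rho_1,\rho_2:W_F\to\mathrm{GL}_2(\overline{\mathbb{Q}}_\ell)$ be a supercuspidal representation and a special representation, respectively, such that $\rho_1(W_F),\rho_2(W_F)\subset\mathrm{GL}_2(\mathcal{O}_K)$, with associated Weil--Deligne representations $\mathrm{Ind}_{W_E}^{W_F}\xi$ and $\chi\omega\oplus\chi$, where $E/F$ is a quadratic extension, $\xi$ is a $1$-dimensional representation of $W_E$ and $\chi$ is a $1$-dimensional representation of $W_F$. Suppose (as may be assumed without loss of generality) that there are upper triangular matrices $U_j=\begin{pmatrix}a_j&b_j\\0&d_j\end{pmatrix}\in\mathrm{GL}_2(K)$, $j=1,2$, such that for all $k\in\mathbb{Z}$, $\tau\in I_F$, $$\rho_1(\Phi^k\tau)=U_1\,\mathrm{Ind}_{W_E}^{W_F}\xi(\Phi^k\tau)\,U_1^{-1},$$ $$\rho_2(\Phi^k\tau)=\begin{pmatrix}\chi\omega(\Phi^k\tau)&\frac{a_2}{d_2}t_\ell(\tau)\chi\omega(\Phi^k\tau)+\frac{b_2}{d_2}(\chi(\Phi^k\tau)-\chi\omega(\Phi^k\tau))\\0&\chi(\Phi^k\tau)\end{pmatrix}.$$ Suppose that $a_2/d_2\in\mathcal{O}_K^\times$. If $E/F$ is ramified, then $\overline{\rho}_1$ and $\overline{\rho}_2$ are not isomorphic.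
   Context: $p\neq\ell$ are odd primes. $F/\mathbb{Q}_p$ is a finite extension with residue field of order $q$, Weil group $W_F$ and inertia group $I_F$. $\Phi\in W_F$ is a fixed Frobenius element, and $\omega$ is the character of $W_F$ with $\omega(\Phi^k\tau)=q^{-k}$ for $k\in\mathbb{Z}$, $\tau\in I_F$. $t_\ell:I_F\to\mathbb{Z}_\ell$ is a fixed continuous surjective homomorphism; it satisfies $t_\ell(g\tau g^{-1})=\omega(g)t_\ell(\tau)$. $K/\mathbb{Q}_\ell$ is a finite extension with ring of integers $\mathcal{O}_K$ and maximal ideal $\lambda$. A bar denotes reduction modulo $\lambda$. All representations are continuous. For a quadratic extension $E/F$, $W_E\subset W_F$ has index $2$, $\sigma\in W_F\setminus W_E$ is a fixed element, $\xi^\sigma(h)=\xi(\sigma h\sigma^{-1})$, and $\mathrm{Ind}_{W_E}^{W_F}\xi$ denotes the matrix representation given for $h\in W_E$ by $$h\mapsto\begin{pmatrix}\xi(h)&0\\0&\xi^\sigma(h)\end{pmatrix},\qquad h\sigma\mapsto\begin{pmatrix}0&\xi(h)\\ \xi(\sigma h\sigma)&0\end{pmatrix}.$$ The Weil--Deligne representation associated with a continuous $\rho$ is $(\rho_\Phi,N_\rho)$, where $N_\rho$ is the unique nilpotent matrix with $\rho(\tau)=\exp(t_\ell(\tau)N_\rho)$ for $\tau$ in some open subgroup of $I_F$, and $\rho_\Phi(\Phi^k\tau)=\rho(\Phi^k\tau)\exp(-t_\ell(\tau)N_\rho)$. $\rho$ is (nonexceptional) supercuspidal if its Weil--Deligne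 representation is isomorphic to $(\mathrm{Ind}_{W_E}^{W_F}\xi,0)$ with $E/F$ quadratic and $\xi\neq\xi^\sigma$ (for $p$ odd all supercuspidals are of this form), and special if it is isomorphic to $\left(\chi\omega\oplus\chi,\begin{pmatrix}0&1\\0&0\end{pmatrix}\right)$. *)

theory Defs
  imports "HOL-Analysis.Analysis" "HOL-Algebra.Algebraic_Closure_Type" "HOL-Algebra.QuotRing"
begin

section \<open>Algebraic closures of the p-adic numbers\<close>

abbreviation UR :: "'a::field ring" where
  "UR \<equiv> ring_of_type_algebra"

definition val_dist :: "('a::field \<Rightarrow> real) \<Rightarrow> 'a \<Rightarrow> 'a \<Rightarrow> real" where
  "val_dist v x y = v (x - y)"

definition val_topology :: "('a::field \<Rightarrow> real) \<Rightarrow> 'a topology" where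
  "val_topology v = Metric_space.mtopology UNIV (val_dist v)"

definition Qp :: "('a::field_char_0 \<Rightarrow> real) \<Rightarrow> 'a set" where
  "Qp v = val_topology v closure_of \<rat>"

text \<open>
  The type \<open>'a\<close> is an algebraic closure of the field of p-adic numbers, and \<open>v\<close> is the absolute
  value on it that extends the p-adic one. The p-adic numbers are the completion of the rationals:
  here, the closure of the rationals for an absolute value restricting to the p-adic one, required
  to be complete. Algebraic extensions of it are subfields of the type (sets).
\<close>
locale padic_closure =
  fixes p :: nat and v :: "'a::field_char_0 \<Rightarrow> real"
  assumes prime_p: "Factorial_Ring.prime p"
    and val_nonneg: "v x \<ge> 0"
    and val_eq_0_iff: "v x = 0 \<longleftrightarrow> x = 0"
    and val_mult: "v (x * y) = v x * v y"
    and val_ultrametric: "v (x + y) \<le> max (v x) (v y)"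
    and val_of_int: "n \<noteq> 0 \<Longrightarrow> v (of_int n) = 1 / real p ^ Factorial_Ring.multiplicity (int p) n"
    and complete_Qp: "Metric_space.mcomplete (Qp v) (val_dist v)"
    and algebraic_closure_Qp: "algebraic_closure (UR :: 'a ring) (Qp v)"

definition finite_ext :: "'a::field set \<Rightarrow> 'a set \<Rightarrow> bool" where
  "finite_ext F L \<longleftrightarrow> subfield F UR \<and> subfield L UR \<and> F \<subseteq> L \<and> ring.finite_dimension UR F L"

definition quadratic_ext :: "'a::field set \<Rightarrow> 'a set \<Rightarrow> bool" where
  "quadratic_ext F L \<longleftrightarrow> subfield F UR \<and> subfield L UR \<and> F \<subseteq> L \<and> ring.dimension UR 2 F L"

definition valuation_ring :: "('a::field \<Rightarrow> real) \<Rightarrow> 'a set \<Rightarrow> 'a ring" where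
  "valuation_ring v F = UR\<lparr>carrier := {x \<in> F. v x \<le> 1}\<rparr>"

definition maximal_ideal :: "('a::field \<Rightarrow> real) \<Rightarrow> 'a set \<Rightarrow> 'a set" where
  "maximal_ideal v F = {x \<in> F. v x < 1}"

definition residue_field :: "('a::field \<Rightarrow> real) \<Rightarrow> 'a set \<Rightarrow> 'a set ring" where
  "residue_field v F = valuation_ring v F Quot maximal_ideal v F"

definition residue_card :: "('a::field \<Rightarrow> real) \<Rightarrow> 'a set \<Rightarrow> nat" where
  "residue_card v F = card (carrier (residue_field v F))"

definition value_group :: "('a::field \<Rightarrow> real) \<Rightarrow> 'a set \<Rightarrow> real monoid" where
  "value_group v F = \<lparr>carrier = v ` (F - {0}), monoid.mult = (*), one = 1\<rparr>"

definition ramification_index :: "('a::field \<Rightarrow> real) \<Rightarrow> 'a set \<Rightarrow> 'a set \<Rightarrow> nat" where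
  "ramification_index v F E = card (rcosets\<^bsub>value_group v E\<^esub> (carrier (value_group v F)))"

text \<open>Residue fields of local fields are finite, so no separability condition is involved.\<close>
definition ramified :: "('a::field \<Rightarrow> real) \<Rightarrow> 'a set \<Rightarrow> 'a set \<Rightarrow> bool" where
  "ramified v F E \<longleftrightarrow> ramification_index v F E > 1"


section \<open>Weil groups\<close>

definition Gal :: "'a::field set \<Rightarrow> ('a \<Rightarrow> 'a) set" where
  "Gal F = {g \<in> ring_iso UR UR. \<forall>x\<in>F. g x = x}"

text \<open>
  Two integral elements have the same image in the residue field of the algebraic closure iff
  their difference has absolute value less than 1. The two disjuncts say that \<open>g\<close> acts on that
  residue field as the \<open>n\<close>-th, resp. the \<open>-n\<close>-th power of the map raising to the power \<open>q\<close>.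
\<close>
definition Weil_group :: "('a::field \<Rightarrow> real) \<Rightarrow> 'a set \<Rightarrow> ('a \<Rightarrow> 'a) monoid" where
  "Weil_group v F = \<lparr>carrier = {g \<in> Gal F. \<exists>n::nat.
        (\<forall>x. v x \<le> 1 \<longrightarrow> v (g x - x ^ (residue_card v F ^ n)) < 1) \<or>
        (\<forall>x. v x \<le> 1 \<longrightarrow> v (g x ^ (residue_card v F ^ n) - x) < 1)},
      monoid.mult = (\<circ>), one = id\<rparr>"

definition inertia :: "('a::field \<Rightarrow> real) \<Rightarrow> 'a set \<Rightarrow> ('a \<Rightarrow> 'a) set" where
  "inertia v F = {g \<in> Gal F. \<forall>x. v x \<le> 1 \<longrightarrow> v (g x - x) < 1}"

abbreviation inertia_group :: "('a::field \<Rightarrow> real) \<Rightarrow> 'a set \<Rightarrow> ('a \<Rightarrow> 'a) monoid" where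
  "inertia_group v F \<equiv> Weil_group v F\<lparr>carrier := inertia v F\<rparr>"

text \<open>
  The topology for which inertia is an open subgroup carrying its profinite topology: the left
  cosets of the groups of inertia elements fixing a finite extension \<open>L\<close> of \<open>F\<close> form a basis.
\<close>
definition Weil_topology :: "('a::field \<Rightarrow> real) \<Rightarrow> 'a set \<Rightarrow> ('a \<Rightarrow> 'a) topology" where
  "Weil_topology v F = topology_generated_by
     {g <#\<^bsub>Weil_group v F\<^esub> (inertia v F \<inter> Gal L) | g L. g \<in> carrier (Weil_group v F) \<and> finite_ext F L}"

text \<open>
  Frobenius elements are geometric (inverse to raising to the power \<open>q\<close>). This is the normalization
  forced by \<open>\<omega>(\<Phi>) = q\<^sup>-\<^sup>1\<close> together with \<open>t(g \<tau> g\<^sup>-\<^sup>1) = \<omega>(g) t(\<tau>)\<close>.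
\<close>
definition Frobenius_element :: "('a::field \<Rightarrow> real) \<Rightarrow> 'a set \<Rightarrow> ('a \<Rightarrow> 'a) \<Rightarrow> bool" where
  "Frobenius_element v F \<Phi> \<longleftrightarrow> \<Phi> \<in> carrier (Weil_group v F) \<and>
     (\<forall>x. v x \<le> 1 \<longrightarrow> v (\<Phi> x ^ residue_card v F - x) < 1)"

definition is_omega :: "('a::field \<Rightarrow> real) \<Rightarrow> 'a set \<Rightarrow> ('a \<Rightarrow> 'a) \<Rightarrow> (('a \<Rightarrow> 'a) \<Rightarrow> 'b::field) \<Rightarrow> bool" where
  "is_omega v F \<Phi> \<omega> \<longleftrightarrow> (\<forall>k::int. \<forall>\<tau>\<in>inertia v F.
     \<omega> (\<Phi> [^]\<^bsub>Weil_group v F\<^esub> k \<otimes>\<^bsub>Weil_group v F\<^esub> \<tau>) = of_nat (residue_card v F) powi (- k))"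

text \<open>
  A continuous surjective homomorphism from inertia to the \<open>l\<close>-adic integers, which sit inside the
  algebraic closure \<open>'b\<close> of the \<open>l\<close>-adic numbers with absolute value \<open>w\<close>. Such a homomorphism is
  trivial on wild inertia, so \<open>t(g \<tau> g\<^sup>-\<^sup>1) = \<omega>(g) t(\<tau>)\<close> holds without further assumption.
\<close>
definition tame_hom :: "('a::field \<Rightarrow> real) \<Rightarrow> 'a set \<Rightarrow> ('b::field_char_0 \<Rightarrow> real) \<Rightarrow> (('a \<Rightarrow> 'a) \<Rightarrow> 'b) \<Rightarrow> bool" where
  "tame_hom v F w t \<longleftrightarrow>
     t \<in> hom (inertia_group v F) (add_monoid (valuation_ring w (Qp w))) \<and>
     t ` inertia v F = carrier (valuation_ring w (Qp w)) \<and>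
     continuous_map (subtopology (Weil_topology v F) (inertia v F)) (val_topology w) t"


section \<open>Two-by-two matrices over a ring\<close>

definition mat2 :: "('c, 'm) ring_scheme \<Rightarrow> ('c^2^2) monoid" where
  "mat2 R = \<lparr>carrier = {A. \<forall>i j. A $ i $ j \<in> carrier R},
     monoid.mult = (\<lambda>A B. \<chi> i j. A $ i $ 1 \<otimes>\<^bsub>R\<^esub> B $ 1 $ j \<oplus>\<^bsub>R\<^esub> A $ i $ 2 \<otimes>\<^bsub>R\<^esub> B $ 2 $ j),
     one = (\<chi> i j. if i = j then \<one>\<^bsub>R\<^esub> else \<zero>\<^bsub>R\<^esub>)\<rparr>"

abbreviation GL2 :: "('c, 'm) ring_scheme \<Rightarrow> ('c^2^2) monoid" where
  "GL2 R \<equiv> units_of (mat2 R)"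

abbreviation mtx :: "'c::zero \<Rightarrow> 'c \<Rightarrow> 'c \<Rightarrow> 'c \<Rightarrow> 'c^2^2" where
  "mtx a b c d \<equiv> vector [vector [a, b], vector [c, d]]"

definition mat_scale :: "'b::field \<Rightarrow> 'b^2^2 \<Rightarrow> 'b^2^2" where
  "mat_scale c A = (\<chi> i j. c * A $ i $ j)"

definition mat_nilpotent :: "'b::field^2^2 \<Rightarrow> bool" where
  "mat_nilpotent N \<longleftrightarrow> (\<exists>n::nat. N [^]\<^bsub>mat2 UR\<^esub> n = 0)"

text \<open>The exponential series of a nilpotent matrix, cut off where its powers vanish.\<close>
definition mat_exp :: "'b::field_char_0^2^2 \<Rightarrow> 'b^2^2" where
  "mat_exp N = (\<Sum>k < (LEAST n::nat. N [^]\<^bsub>mat2 UR\<^esub> n = 0). mat_scale (1 / fact k) (N [^]\<^bsub>mat2 UR\<^esub> k))"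


section \<open>Representations\<close>

definition character ::
  "('a::field \<Rightarrow> real) \<Rightarrow> 'a set \<Rightarrow> ('b::field \<Rightarrow> real) \<Rightarrow> (('a \<Rightarrow> 'a) \<Rightarrow> 'b) \<Rightarrow> bool" where
  "character v F w chi \<longleftrightarrow> chi \<in> hom (Weil_group v F) (units_of UR) \<and>
     continuous_map (Weil_topology v F) (val_topology w) chi"

definition representation ::
  "('a::field \<Rightarrow> real) \<Rightarrow> 'a set \<Rightarrow> ('b::field \<Rightarrow> real) \<Rightarrow> (('a \<Rightarrow> 'a) \<Rightarrow> 'b^2^2) \<Rightarrow> bool" where
  "representation v F w \<rho> \<longleftrightarrow> \<rho> \<in> hom (Weil_group v F) (GL2 UR) \<and>
     (\<forall>i j. continuous_map (Weil_topology v F) (val_topology w) (\<lambda>g. \<rho> g $ i $ j))"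

definition rep_iso :: "('g, 'n) monoid_scheme \<Rightarrow> ('c, 'm) ring_scheme \<Rightarrow> ('g \<Rightarrow> 'c^2^2) \<Rightarrow> ('g \<Rightarrow> 'c^2^2) \<Rightarrow> bool" where
  "rep_iso G R \<rho> \<rho>' \<longleftrightarrow> (\<exists>P\<in>carrier (GL2 R). \<forall>g\<in>carrier G.
     P \<otimes>\<^bsub>mat2 R\<^esub> \<rho> g = \<rho>' g \<otimes>\<^bsub>mat2 R\<^esub> P)"

definition reduction ::
  "('b::field \<Rightarrow> real) \<Rightarrow> 'b set \<Rightarrow> ('g \<Rightarrow> 'b^2^2) \<Rightarrow> 'g \<Rightarrow> ('b set)^2^2" where
  "reduction w K \<rho> g = (\<chi> i j. maximal_ideal w K +>\<^bsub>valuation_ring w K\<^esub> (\<rho> g $ i $ j))"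

definition conj_char ::
  "('a::field \<Rightarrow> real) \<Rightarrow> 'a set \<Rightarrow> ('a \<Rightarrow> 'a) \<Rightarrow> (('a \<Rightarrow> 'a) \<Rightarrow> 'b) \<Rightarrow> ('a \<Rightarrow> 'a) \<Rightarrow> 'b" where
  "conj_char v F \<sigma> \<xi> h =
     \<xi> (\<sigma> \<otimes>\<^bsub>Weil_group v F\<^esub> h \<otimes>\<^bsub>Weil_group v F\<^esub> inv\<^bsub>Weil_group v F\<^esub> \<sigma>)"

definition Ind ::
  "('a::field \<Rightarrow> real) \<Rightarrow> 'a set \<Rightarrow> 'a set \<Rightarrow> ('a \<Rightarrow> 'a) \<Rightarrow> (('a \<Rightarrow> 'a) \<Rightarrow> 'b::field) \<Rightarrow> ('a \<Rightarrow> 'a) \<Rightarrow> 'b^2^2" where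
  "Ind v F E \<sigma> \<xi> g =
     (if g \<in> carrier (Weil_group v E) then mtx (\<xi> g) 0 0 (conj_char v F \<sigma> \<xi> g)
      else let h = g \<otimes>\<^bsub>Weil_group v F\<^esub> inv\<^bsub>Weil_group v F\<^esub> \<sigma>
        in mtx 0 (\<xi> h) (\<xi> (\<sigma> \<otimes>\<^bsub>Weil_group v F\<^esub> h \<otimes>\<^bsub>Weil_group v F\<^esub> \<sigma>)) 0)"

text \<open>The pair \<open>(r, N)\<close> is the Weil--Deligne representation associated with \<open>\<rho>\<close>.\<close>
definition Weil_Deligne ::
  "('a::field \<Rightarrow> real) \<Rightarrow> 'a set \<Rightarrow> ('a \<Rightarrow> 'a) \<Rightarrow> (('a \<Rightarrow> 'a) \<Rightarrow> 'b::field_char_0) \<Rightarrow>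
     (('a \<Rightarrow> 'a) \<Rightarrow> 'b^2^2) \<Rightarrow> (('a \<Rightarrow> 'a) \<Rightarrow> 'b^2^2) \<Rightarrow> 'b^2^2 \<Rightarrow> bool" where
  "Weil_Deligne v F \<Phi> t \<rho> r N \<longleftrightarrow>
     mat_nilpotent N \<and>
     (\<exists>H. subgroup H (inertia_group v F) \<and>
        openin (subtopology (Weil_topology v F) (inertia v F)) H \<and>
        (\<forall>\<tau>\<in>H. \<rho> \<tau> = mat_exp (mat_scale (t \<tau>) N))) \<and>
     (\<forall>k::int. \<forall>\<tau>\<in>inertia v F.
        r (\<Phi> [^]\<^bsub>Weil_group v F\<^esub> k \<otimes>\<^bsub>Weil_group v F\<^esub> \<tau>) =
        \<rho> (\<Phi> [^]\<^bsub>Weil_group v F\<^esub> k \<otimes>\<^bsub>Weil_group v F\<^esub> \<tau>) \<otimes>\<^bsub>mat2 UR\<^esub> mat_exp (mat_scale (- t \<tau>) N))"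

definition WD_iso ::
  "('g, 'n) monoid_scheme \<Rightarrow> ('g \<Rightarrow> 'b::field^2^2) \<Rightarrow> 'b^2^2 \<Rightarrow> ('g \<Rightarrow> 'b^2^2) \<Rightarrow> 'b^2^2 \<Rightarrow> bool" where
  "WD_iso G r N r' N' \<longleftrightarrow> (\<exists>P\<in>carrier (GL2 UR).
     (\<forall>g\<in>carrier G. P \<otimes>\<^bsub>mat2 UR\<^esub> r g = r' g \<otimes>\<^bsub>mat2 UR\<^esub> P) \<and>
     P \<otimes>\<^bsub>mat2 UR\<^esub> N = N' \<otimes>\<^bsub>mat2 UR\<^esub> P)"

text \<open>Supercuspidal, respectively special, with the data of the Weil--Deligne representation.\<close>
definition supercuspidal_with ::
  "('a::field \<Rightarrow> real) \<Rightarrow> 'a set \<Rightarrow> ('a \<Rightarrow> 'a) \<Rightarrow> ('b::field_char_0 \<Rightarrow> real) \<Rightarrow> (('a \<Rightarrow> 'a) \<Rightarrow> 'b) \<Rightarrow>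
     'a set \<Rightarrow> ('a \<Rightarrow> 'a) \<Rightarrow> (('a \<Rightarrow> 'a) \<Rightarrow> 'b) \<Rightarrow> (('a \<Rightarrow> 'a) \<Rightarrow> 'b^2^2) \<Rightarrow> bool" where
  "supercuspidal_with v F \<Phi> w t E \<sigma> \<xi> \<rho> \<longleftrightarrow>
     representation v F w \<rho> \<and> quadratic_ext F E \<and>
     \<sigma> \<in> carrier (Weil_group v F) - carrier (Weil_group v E) \<and>
     character v E w \<xi> \<and> (\<exists>h\<in>carrier (Weil_group v E). \<xi> h \<noteq> conj_char v F \<sigma> \<xi> h) \<and>
     (\<exists>r N. Weil_Deligne v F \<Phi> t \<rho> r N \<and> WD_iso (Weil_group v F) r N (Ind v F E \<sigma> \<xi>) 0)"

definition special_with ::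
  "('a::field \<Rightarrow> real) \<Rightarrow> 'a set \<Rightarrow> ('a \<Rightarrow> 'a) \<Rightarrow> (('a \<Rightarrow> 'a) \<Rightarrow> 'b) \<Rightarrow> ('b::field_char_0 \<Rightarrow> real) \<Rightarrow>
     (('a \<Rightarrow> 'a) \<Rightarrow> 'b) \<Rightarrow> (('a \<Rightarrow> 'a) \<Rightarrow> 'b) \<Rightarrow> (('a \<Rightarrow> 'a) \<Rightarrow> 'b^2^2) \<Rightarrow> bool" where
  "special_with v F \<Phi> \<omega> w t chi \<rho> \<longleftrightarrow>
     representation v F w \<rho> \<and> character v F w chi \<and>
     (\<exists>r N. Weil_Deligne v F \<Phi> t \<rho> r N \<and>
        WD_iso (Weil_group v F) r N (\<lambda>g. mtx (chi g * \<omega> g) 0 0 (chi g)) (mtx 0 1 0 0))"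

end

theory Submission
  imports Defs
begin

text \<open>
  If \<open>E/F\<close> is ramified, some \<open>g\<close> in the inertia group of \<open>F\<close> moves an element of \<open>E\<close>. An induced
  representation has trace 0 at such \<open>g\<close>, whereas \<open>\<rho>2 g\<close> has trace \<open>2 \<chi>(g)\<close>, a unit because \<open>l\<close>
  is odd; isomorphic reductions would have congruent traces.

  To find \<open>g\<close>, take a maximal field \<open>M\<close> above \<open>F\<close> with the same value group as \<open>F\<close>. Its residue field
  is that of the algebraic closure, so every automorphism over \<open>M\<close> lies in inertia, provided it
  preserves the absolute value; this holds by completeness of the \<open>p\<close>-adic numbers. An element of
  \<open>E\<close> whose absolute value is not attained on \<open>F\<close> is not in \<open>M\<close>, hence is moved by some
  automorphism over \<open>M\<close>.
\<close>

section \<open>Extending homomorphisms to an algebraic closure\<close>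

text \<open>When \<open>F\<close> is a finite extension of the p-adic numbers, \<open>M\<close> is
  the maximal unramified extension of \<open>F\<close>. A residue class missed by \<open>M\<close>
  could still be added: a monic lift to \<open>M\<close> of its minimal polynomial is small at any
  representative, so one of its roots in the closure is close to that representative. Algebraic
  closedness thus does the work of Hensel's lemma. Adjoining the root creates no new absolute
  values, because a normalized polynomial of smaller degree cannot be small at the class. Membership
  in inertia needs control of \<open>g\<close> on every integral \<open>y\<close>, not only on
  \<open>M\<close>: \<open>y\<close> has distance less than 1 from some \<open>m\<close> in
  \<open>M\<close>, and \<open>g y - y = g (y - m) - (y - m)\<close> is small once \<open>g\<close>
  preserves \<open>v\<close>. Since \<open>Gal\<close> consists of bare field automorphisms, this
  invariance has to be proved; it comes from comparing \<open>v\<close> and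
  \<open>v \<circ> g\<close> on finite-dimensional spaces over a complete field. Traces fit the
  final comparison because they are additive, hence commute with reduction, and are invariant under
  conjugation over any commutative ring.\<close>

lemma UR_simps [simp]:
  "carrier (UR :: 'c::field ring) = UNIV"
  "x \<otimes>\<^bsub>UR\<^esub> y = x * (y :: 'c)" "x \<oplus>\<^bsub>UR\<^esub> y = x + y"
  "\<one>\<^bsub>UR\<^esub> = (1 :: 'c)" "\<zero>\<^bsub>UR\<^esub> = (0 :: 'c)"
  by (simp_all add: ring_of_type_algebra_def)

lemma UR_a_inv [simp]: "\<ominus>\<^bsub>UR\<^esub> x = - (x :: 'c::field)"
proof -
  interpret ring "UR :: 'c ring" by (rule ring_from_type_algebra)
  show ?thesis using minus_equality[of "-x" x] by simp
qed

lemma UR_nat_pow [simp]: "x [^]\<^bsub>UR\<^esub> (n::nat) = (x :: 'c::field) ^ n"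
proof -
  interpret ring "UR :: 'c ring" by (rule ring_from_type_algebra)
  show ?thesis by (induction n) (simp_all add: mult.commute)
qed

lemma UR_m_inv:
  assumes "x \<noteq> 0"
  shows "inv\<^bsub>UR\<^esub> x = inverse (x :: 'c::field)"
proof -
  interpret ring "UR :: 'c ring" by (rule ring_from_type_algebra)
  show ?thesis
    using assms by (intro inv_unique'[symmetric]) simp_all
qed

lemma subring_UR_iff:
  "subring S (UR :: 'c::field ring) \<longleftrightarrow>
     1 \<in> S \<and> (\<forall>x\<in>S. \<forall>y\<in>S. x + y \<in> S \<and> x * y \<in> S) \<and> (\<forall>x\<in>S. - x \<in> S)"
proof
  assume "subring S (UR :: 'c ring)"
  then show "1 \<in> S \<and> (\<forall>x\<in>S. \<forall>y\<in>S. x + y \<in> S \<and> x * y \<in> S) \<and> (\<forall>x\<in>S. - x \<in> S)"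
    using subringE[of S "UR :: 'c ring"] by auto
next
  interpret ring "UR :: 'c ring" by (rule ring_from_type_algebra)
  assume "1 \<in> S \<and> (\<forall>x\<in>S. \<forall>y\<in>S. x + y \<in> S \<and> x * y \<in> S) \<and> (\<forall>x\<in>S. - x \<in> S)"
  then show "subring S (UR :: 'c ring)"
    by (intro subringI) auto
qed

lemma subring_UR_closed:
  assumes "subring S (UR :: 'c::field ring)"
  shows "0 \<in> S" "1 \<in> S" "x \<in> S \<Longrightarrow> - x \<in> S" "x \<in> S \<Longrightarrow> y \<in> S \<Longrightarrow> x + y \<in> S"
    "x \<in> S \<Longrightarrow> y \<in> S \<Longrightarrow> x - y \<in> S" "x \<in> S \<Longrightarrow> y \<in> S \<Longrightarrow> x * y \<in> S"
    "x \<in> S \<Longrightarrow> x ^ n \<in> S" "(\<And>i. i \<in> I \<Longrightarrow> f i \<in> S) \<Longrightarrow> sum f I \<in> S"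
proof -
  have S: "1 \<in> S" "\<And>x y. x \<in> S \<Longrightarrow> y \<in> S \<Longrightarrow> x + y \<in> S"
    "\<And>x y. x \<in> S \<Longrightarrow> y \<in> S \<Longrightarrow> x * y \<in> S" "\<And>x. x \<in> S \<Longrightarrow> - x \<in> S"
    using assms by (auto simp: subring_UR_iff)
  have 0: "0 \<in> S" using S(2)[OF S(1) S(4)[OF S(1)]] by simp
  show "0 \<in> S" "1 \<in> S" "x \<in> S \<Longrightarrow> - x \<in> S" "x \<in> S \<Longrightarrow> y \<in> S \<Longrightarrow> x + y \<in> S"
    "x \<in> S \<Longrightarrow> y \<in> S \<Longrightarrow> x * y \<in> S"
    by (auto intro: S 0)
  show "x \<in> S \<Longrightarrow> y \<in> S \<Longrightarrow> x - y \<in> S"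
    using S(2)[OF _ S(4)[of y], of x] by simp
  show "x \<in> S \<Longrightarrow> x ^ n \<in> S" by (induction n) (auto intro: S)
  show "(\<And>i. i \<in> I \<Longrightarrow> f i \<in> S) \<Longrightarrow> sum f I \<in> S"
    by (induction I rule: infinite_finite_induct) (auto intro: S 0)
qed

lemma subfield_UR_inverse:
  assumes "subfield L (UR :: 'c::field ring)" "x \<in> L"
  shows "inverse x \<in> L"
proof (cases "x = 0")
  case True
  then show ?thesis using assms(2) by simp
next
  case False
  interpret field "UR :: 'c ring" by (rule field_from_type_algebra)
  show ?thesis
    using subfield_m_inv(1)[OF assms(1), of x] assms(2) False by (simp add: UR_m_inv)
qed

lemma poly_in_subring:
  assumes "subring S (UR :: 'c::field ring)" "\<And>i. poly.coeff f i \<in> S" "x \<in> S"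
  shows "poly f x \<in> S"
  unfolding poly_altdef using assms by (intro subring_UR_closed(6-8)) auto

text \<open>Partial homomorphisms over \<open>k\<close> are encoded by their graphs, so that extension is inclusion.\<close>
definition hom_graph :: "'a::field set \<Rightarrow> ('a \<times> 'a) set \<Rightarrow> bool" where
  "hom_graph k G \<longleftrightarrow> (\<forall>a\<in>k. (a, a) \<in> G) \<and>
     (\<forall>x y x' y'. (x, y) \<in> G \<longrightarrow> (x', y') \<in> G \<longrightarrow>
        (x + x', y + y') \<in> G \<and> (x - x', y - y') \<in> G \<and> (x * x', y * y') \<in> G) \<and>
     (\<forall>y. (0, y) \<in> G \<longrightarrow> y = 0)"

lemma hom_graphD:
  assumes "hom_graph k G"
  shows "a \<in> k \<Longrightarrow> (a, a) \<in> G"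
    "(x, y) \<in> G \<Longrightarrow> (x', y') \<in> G \<Longrightarrow> (x + x', y + y') \<in> G"
    "(x, y) \<in> G \<Longrightarrow> (x', y') \<in> G \<Longrightarrow> (x - x', y - y') \<in> G"
    "(x, y) \<in> G \<Longrightarrow> (x', y') \<in> G \<Longrightarrow> (x * x', y * y') \<in> G"
    "(0, y) \<in> G \<Longrightarrow> y = 0"
  using assms by (simp_all add: hom_graph_def)

text \<open>Subtracting the two pairs reduces single-valuedness to the condition on pairs
  \<open>(0, y)\<close>.\<close>

lemma hom_graph_unique:
  assumes "hom_graph k G" "(x, y) \<in> G" "(x, y') \<in> G"
  shows "y = y'"
  using hom_graphD(5)[OF assms(1), of "y - y'"] hom_graphD(3)[OF assms] by simp

text \<open>Algebraic closedness in terms of \<open>poly\<close>. Roots are required for all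
  polynomials over the type, so the conditions persist when \<open>k\<close> is replaced by a larger
  subfield.\<close>

locale algebraic_subfield =
  fixes k :: "'a::field_char_0 set"
  assumes subfield: "subfield k UR"
    and algebraic: "\<exists>f. f \<noteq> 0 \<and> (\<forall>i. poly.coeff f i \<in> k) \<and> poly f x = 0"
    and root_exists: "Polynomial.degree (g :: 'a poly) > 0 \<Longrightarrow> \<exists>x. poly g x = 0"
begin

lemma subring_k: "subring k UR"
  using subfield by (simp add: subfieldE)

text \<open>Write a polynomial over \<open>k\<close> of least degree vanishing at \<open>x\<close>
  as \<open>c + X * g\<close>; then \<open>inverse x = - g(x) / c\<close>. Hence rings above
  \<open>k\<close> are fields, and the constructions below need only produce subrings.\<close>

lemma inverse_in_overring:
  assumes "subring R UR" "k \<subseteq> R" "x \<in> R"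
  shows "inverse x \<in> R"
proof (cases "x = 0")
  case True
  then show ?thesis using assms by simp
next
  case False
  define P where "P f \<longleftrightarrow> f \<noteq> 0 \<and> (\<forall>i. poly.coeff f i \<in> k) \<and> poly f x = 0" for f
  obtain f where f: "P f" and min: "\<And>g. P g \<Longrightarrow> Polynomial.degree f \<le> Polynomial.degree g"
    using algebraic[of x] ex_has_least_nat[of P _ Polynomial.degree] unfolding P_def by metis
  obtain c g where fg: "f = pCons c g" by (cases f)
  have g: "poly.coeff g i \<in> k" for i
    using f by (auto simp: P_def fg dest: spec[of _ "Suc i"])
  have c: "c \<in> k" using f by (auto simp: P_def fg dest: spec[of _ 0])
  \<comment> \<open>If the constant term vanished, cancelling a factor \<open>x\<close> would give a
    relation of smaller degree.\<close>
  have "c \<noteq> 0"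
  proof
    assume "c = 0"
    then have "P g" using f g False by (auto simp: P_def fg)
    then have "Polynomial.degree f \<le> Polynomial.degree g" "g \<noteq> 0"
      using min by (auto simp: P_def)
    then show False by (simp add: fg)
  qed
  have "c + x * poly g x = 0" using f by (simp add: P_def fg)
  then have "x * poly g x = - c" by (simp add: add_eq_0_iff)
  then have "inverse x = - (poly g x * inverse c)"
    using False \<open>c \<noteq> 0\<close> by (simp add: field_simps)
  moreover have "inverse c \<in> R" using subfield_UR_inverse[OF subfield c] assms by auto
  moreover have "poly g x \<in> R" using g assms by (intro poly_in_subring) auto
  ultimately show ?thesis using assms by (auto intro: subring_UR_closed)
qed

text \<open>Adjunction of one element: \<open>f0\<close> is the minimal polynomial of
  \<open>x\<close> over the domain of \<open>G\<close>, \<open>g0\<close> its image under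
  \<open>G\<close>, and \<open>x\<close> is sent to a root \<open>x'\<close> of \<open>g0\<close>.
  The new graph consists of the values at \<open>x\<close> and \<open>x'\<close> of corresponding
  polynomials.\<close>

lemma hom_graph_extend:
  assumes G: "hom_graph k G"
    and f0: "\<And>i. (poly.coeff f0 i, poly.coeff g0 i) \<in> G" "Polynomial.lead_coeff f0 = 1"
      "poly f0 x = 0" "poly g0 x' = 0"
    and min: "\<And>f. f \<noteq> 0 \<Longrightarrow> (\<And>i. poly.coeff f i \<in> fst ` G) \<Longrightarrow> poly f x = 0 \<Longrightarrow>
      Polynomial.degree f0 \<le> Polynomial.degree f"
  shows "\<exists>G'. hom_graph k G' \<and> G \<subseteq> G' \<and> (x, x') \<in> G'"
proof -
  note G = hom_graphD[OF G]
  have one: "(1, 1) \<in> G" "(0, 0) \<in> G"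
    using subring_UR_closed[OF subring_k] G(1) by auto
  have sum: "(sum a A, sum b A) \<in> G" if "\<And>i. i \<in> A \<Longrightarrow> (a i, b i) \<in> G" for a b and A :: "nat set"
    using that by (induction A rule: infinite_finite_induct) (auto intro: G one)
  define P where "P f g \<longleftrightarrow> (\<forall>i. (poly.coeff f i, poly.coeff g i) \<in> G)" for f g
  have P_add: "P (f + f') (g + g')" and P_diff: "P (f - f') (g - g')"
    and P_mult: "P (f * f') (g * g')" if "P f g" "P f' g'" for f g f' g'
    using that unfolding P_def coeff_add coeff_diff coeff_mult by (auto intro!: G sum)
  have P_monom: "P (Polynomial.monom c n) (Polynomial.monom c' n)" if "(c, c') \<in> G" for c c' n
    using that one by (auto simp: P_def)
  have P0: "P f0 g0" using f0 by (simp add: P_def)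
  \<comment> \<open>Well-definedness: long division by \<open>f0\<close> is carried out on
    \<open>f\<close> and, in parallel, by \<open>g0\<close> on \<open>g\<close>. Minimality of
    \<open>f0\<close> lets it continue until \<open>f\<close> is exhausted, and a partner of the
    zero polynomial is zero.\<close>
  have key: "poly f x = 0 \<Longrightarrow> poly g x' = 0" if "P f g" for f g
    using that
  proof (induction "Polynomial.degree f" arbitrary: f g rule: less_induct)
    case less
    have zero: "poly g x' = 0" if "P 0 g" for g
    proof -
      have "g = 0" using that by (intro poly_eqI) (auto simp: P_def intro: G)
      then show ?thesis by simp
    qed
    show ?case
    proof (cases "f = 0")
      case True
      then show ?thesis using less.prems zero by blast
    next
      case False
      define n where "n = Polynomial.degree f"
      have "poly.coeff f i \<in> fst ` G" for i
        using less.prems by (force simp: P_def)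
      then have le: "Polynomial.degree f0 \<le> n"
        unfolding n_def using min False less.prems by blast
      define m where "m = n - Polynomial.degree f0"
      define f1 where "f1 = f - Polynomial.monom (poly.coeff f n) m * f0"
      define g1 where "g1 = g - Polynomial.monom (poly.coeff g n) m * g0"
      have P1: "P f1 g1"
        unfolding f1_def g1_def
        by (intro P_diff P_mult P_monom P0 less.prems) (use less.prems in \<open>auto simp: P_def\<close>)
      have "Polynomial.degree (Polynomial.monom (poly.coeff f n) m * f0) \<le> n"
        by (rule order_trans[OF degree_mult_le])
          (use le degree_monom_le[of "poly.coeff f n" m] in \<open>simp add: m_def\<close>)
      then have "Polynomial.degree f1 \<le> n"
        unfolding f1_def by (intro degree_diff_le) (auto simp: n_def)
      moreover have "poly.coeff f1 n = 0"
        using f0(2) le by (simp add: f1_def coeff_monom_mult m_def)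
      ultimately have "f1 = 0 \<or> Polynomial.degree f1 < n"
        by (rule eq_zero_or_degree_less)
      moreover have "poly f1 x = 0" using less.prems f0 by (simp add: f1_def)
      ultimately have "poly g1 x' = 0"
        using less.hyps P1 zero unfolding n_def by blast
      then show ?thesis using f0 by (simp add: g1_def)
    qed
  qed
  define G' where "G' = {(poly f x, poly g x') | f g. P f g}"
  have "(a, b) \<in> G'" if "(a, b) \<in> G" for a b
    using P_monom[OF that, of 0] unfolding G'_def by (force simp: poly_monom)
  then have sub: "G \<subseteq> G'" by auto
  moreover have "hom_graph k G'"
    unfolding hom_graph_def
  proof (intro conjI allI impI ballI)
    fix a assume "a \<in> k"
    then show "(a, a) \<in> G'" using G(1) sub by auto
  next
    fix y assume "(0, y) \<in> G'"
    then show "y = 0" using key by (auto simp: G'_def)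
  next
    fix a b a' b' assume "(a, b) \<in> G'" "(a', b') \<in> G'"
    then obtain f g f' g' where *: "P f g" "P f' g'" "a = poly f x" "b = poly g x'"
      "a' = poly f' x" "b' = poly g' x'" unfolding G'_def by blast
    show "(a + a', b + b') \<in> G'" using P_add[OF *(1,2)] * unfolding G'_def by force
    show "(a - a', b - b') \<in> G'" using P_diff[OF *(1,2)] * unfolding G'_def by force
    show "(a * a', b * b') \<in> G'" using P_mult[OF *(1,2)] * unfolding G'_def by force
  qed
  moreover have "(x, x') \<in> G'"
    using P_monom[OF one(1), of 1] unfolding G'_def by (force simp: poly_monom)
  ultimately show ?thesis by blast
qed

text \<open>The leading coefficient can be divided out inside \<open>R\<close>, since
  \<open>R\<close> is a field by \<open>inverse_in_overring\<close>.\<close>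

lemma minimal_polynomial_exists:
  assumes R: "subring R UR" "k \<subseteq> R"
  obtains f where "Polynomial.lead_coeff f = 1" "\<And>i. poly.coeff f i \<in> R" "poly f x = 0"
    "\<And>g. g \<noteq> 0 \<Longrightarrow> (\<And>i. poly.coeff g i \<in> R) \<Longrightarrow> poly g x = 0 \<Longrightarrow>
      Polynomial.degree f \<le> Polynomial.degree g"
proof -
  define P where "P f \<longleftrightarrow> f \<noteq> 0 \<and> (\<forall>i. poly.coeff f i \<in> R) \<and> poly f x = 0" for f
  obtain f where f: "P f" and min: "\<And>g. P g \<Longrightarrow> Polynomial.degree f \<le> Polynomial.degree g"
    using algebraic[of x] ex_has_least_nat[of P _ Polynomial.degree] R(2) unfolding P_def
    by (metis subsetD)
  define c where "c = inverse (Polynomial.lead_coeff f)"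
  have c: "c \<in> R" "c \<noteq> 0"
    using f inverse_in_overring[OF R] by (auto simp: P_def c_def)
  show ?thesis
  proof (rule that[of "Polynomial.smult c f"])
    show "poly.coeff (Polynomial.smult c f) i \<in> R" for i
      using f c R by (auto simp: P_def intro: subring_UR_closed)
    show "Polynomial.lead_coeff (Polynomial.smult c f) = 1"
      using f by (simp add: P_def c_def)
    show "poly (Polynomial.smult c f) x = 0" using f by (simp add: P_def)
    show "Polynomial.degree (Polynomial.smult c f) \<le> Polynomial.degree g"
      if "g \<noteq> 0" "\<And>i. poly.coeff g i \<in> R" "poly g x = 0" for g
      using min[of g] that c by (simp add: P_def)
  qed
qed

text \<open>Zorn's lemma for graphs under inclusion. A maximal graph has full domain, because the
  image of a minimal polynomial has a root and so any further element could be adjoined.\<close>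

lemma hom_graph_maximal:
  assumes "hom_graph k G0"
  obtains G where "hom_graph k G" "G0 \<subseteq> G" "fst ` G = UNIV"
proof -
  define A where "A = {G. hom_graph k G \<and> G0 \<subseteq> G}"
  have "\<exists>G\<in>A. \<forall>H\<in>A. G \<subseteq> H \<longrightarrow> H = G"
  proof (rule subset_Zorn_nonempty)
    show "A \<noteq> {}" using assms by (auto simp: A_def)
  next
    fix C assume C: "C \<noteq> {}" "subset.chain A C"
    then have CA: "\<And>G. G \<in> C \<Longrightarrow> hom_graph k G \<and> G0 \<subseteq> G"
      by (auto simp: subset.chain_def A_def)
    have "hom_graph k (\<Union>C)"
      unfolding hom_graph_def
    proof (intro conjI allI impI ballI)
      fix a assume "a \<in> k"
      then show "(a, a) \<in> \<Union>C" using C(1) CA hom_graphD(1) by fastforce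
    next
      fix y assume "(0, y) \<in> \<Union>C"
      then show "y = 0" using CA hom_graphD(5) by fastforce
    next
      fix x y x' y' assume "(x, y) \<in> \<Union>C" "(x', y') \<in> \<Union>C"
      then obtain G G' where "G \<in> C" "G' \<in> C" "(x, y) \<in> G" "(x', y') \<in> G'" by blast
      moreover from this have "G \<subseteq> G' \<or> G' \<subseteq> G"
        using C(2) by (auto simp: subset.chain_def)
      ultimately obtain H where H: "H \<in> C" "(x, y) \<in> H" "(x', y') \<in> H" by blast
      show "(x + x', y + y') \<in> \<Union>C" "(x - x', y - y') \<in> \<Union>C" "(x * x', y * y') \<in> \<Union>C"
        using H CA[OF H(1)] hom_graphD(2-4)[of k H x y x' y'] by blast+
    qed
    then show "\<Union>C \<in> A" using C(1) CA by (auto simp: A_def)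
  qed
  then obtain G where G: "hom_graph k G" "G0 \<subseteq> G"
    and max: "\<And>H. hom_graph k H \<Longrightarrow> G0 \<subseteq> H \<Longrightarrow> G \<subseteq> H \<Longrightarrow> H = G"
    by (auto simp: A_def)
  note GD = hom_graphD[OF G(1)]
  define L where "L = fst ` G"
  have kL: "k \<subseteq> L" using GD(1) by (force simp: L_def)
  have one: "(0, 0) \<in> G" using subring_UR_closed(1)[OF subring_k] GD(1) by blast
  have L: "subring L UR"
    unfolding subring_UR_iff
  proof (intro conjI ballI)
    show "1 \<in> L" using kL subring_UR_closed(2)[OF subring_k] by blast
    fix a assume "a \<in> L"
    then obtain b where b: "(a, b) \<in> G" by (auto simp: L_def)
    show "- a \<in> L" using GD(3)[OF one b] by (force simp: L_def)
    fix a' assume "a' \<in> L"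
    then obtain b' where b': "(a', b') \<in> G" by (auto simp: L_def)
    show "a + a' \<in> L" "a * a' \<in> L"
      using GD(2)[OF b b'] GD(4)[OF b b'] by (force simp: L_def)+
  qed
  have "x \<in> L" for x
  proof -
    obtain f where f: "Polynomial.lead_coeff f = 1" "\<And>i. poly.coeff f i \<in> L" "poly f x = 0"
      and min: "\<And>g. g \<noteq> 0 \<Longrightarrow> (\<And>i. poly.coeff g i \<in> L) \<Longrightarrow> poly g x = 0 \<Longrightarrow>
        Polynomial.degree f \<le> Polynomial.degree g"
      using minimal_polynomial_exists[OF L kL, of x] by metis
    have "\<exists>b. (poly.coeff f i, b) \<in> G" for i using f(2)[of i] by (auto simp: L_def)
    then obtain b where b: "\<And>i. (poly.coeff f i, b i) \<in> G" by metis
    have b0: "b i = 0" if "i > Polynomial.degree f" for i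
      using b[of i] GD(5) that by (simp add: coeff_eq_0)
    \<comment> \<open>The image of \<open>f\<close> under the partial homomorphism. Its coefficients
      vanish beyond the degree of \<open>f\<close>, and the coefficient there is 1, so
      \<open>g\<close> is nonconstant and has a root.\<close>
    define g where "g = Abs_poly b"
    have cg: "poly.coeff g = b"
      unfolding g_def by (rule Abs_poly_inverse) (auto simp: MOST_nat intro!: exI b0)
    have "(1, 1) \<in> G" using subring_UR_closed(2)[OF subring_k] GD(1) by blast
    then have b1: "b (Polynomial.degree f) = 1"
      using b[of "Polynomial.degree f"] f(1) hom_graph_unique[OF G(1)] by auto
    have "Polynomial.degree f \<noteq> 0"
    proof
      assume "Polynomial.degree f = 0"
      then obtain c where "f = [:c:]" by (metis degree_eq_zeroE)
      then show False using f by simp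
    qed
    moreover have "Polynomial.degree f \<le> Polynomial.degree g"
      by (rule le_degree) (simp add: cg b1)
    ultimately obtain x' where "poly g x' = 0" using root_exists[of g] by auto
    then obtain G' where "hom_graph k G'" "G \<subseteq> G'" "(x, x') \<in> G'"
      using hom_graph_extend[OF G(1), of f g x x'] b f min cg by (auto simp: L_def)
    then have "(x, x') \<in> G" using max[of G'] G(2) by auto
    then show "x \<in> L" by (force simp: L_def)
  qed
  then have "fst ` G = UNIV" unfolding L_def by blast
  then show ?thesis using G that by blast
qed

text \<open>In characteristic 0 the minimal polynomial of \<open>x\<close> over \<open>M\<close> is
  separable and, as \<open>x\<close> is not in \<open>M\<close>, has a second root
  \<open>x'\<close>. Sending \<open>x\<close> to \<open>x'\<close> extends to an
  automorphism.\<close>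

lemma automorphism_moving:
  assumes M: "subring M UR" "k \<subseteq> M" and x: "x \<notin> M"
  obtains \<phi> where "\<phi> \<in> ring_iso UR UR" "\<And>a. a \<in> M \<Longrightarrow> \<phi> a = a" "\<phi> x \<noteq> x"
proof -
  have M': "subfield M UR"
  proof -
    interpret field "UR :: 'a ring" by (rule field_from_type_algebra)
    show ?thesis
      using M inverse_in_overring[OF M] by (intro subfieldI') (auto simp: UR_m_inv)
  qed
  interpret M: algebraic_subfield M
  proof (rule algebraic_subfield.intro)
    show "subfield M UR" by (rule M')
    show "\<exists>f. f \<noteq> 0 \<and> (\<forall>i. poly.coeff f i \<in> M) \<and> poly f x = 0" for x
      using algebraic[of x] M(2) by blast
    show "Polynomial.degree g > 0 \<Longrightarrow> \<exists>x. poly g x = 0" for g :: "'a poly"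
      by (rule root_exists)
  qed
  obtain f where f: "Polynomial.lead_coeff f = 1" "\<And>i. poly.coeff f i \<in> M" "poly f x = 0"
    and min: "\<And>g. g \<noteq> 0 \<Longrightarrow> (\<And>i. poly.coeff g i \<in> M) \<Longrightarrow> poly g x = 0 \<Longrightarrow>
      Polynomial.degree f \<le> Polynomial.degree g"
    using minimal_polynomial_exists[OF M, of x] by metis
  have deg0: "Polynomial.degree f \<noteq> 0"
  proof
    assume "Polynomial.degree f = 0"
    then obtain c where "f = [:c:]" by (metis degree_eq_zeroE)
    then show False using f by simp
  qed
  \<comment> \<open>Separability: the derivative is a nonzero polynomial over \<open>M\<close> of
    smaller degree than \<open>f\<close>.\<close>
  have "poly (pderiv f) x \<noteq> 0"
  proof
    assume *: "poly (pderiv f) x = 0"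
    have "poly.coeff (pderiv f) i \<in> M" for i
    proof -
      have "of_nat n \<in> M" for n :: nat
        by (induction n) (auto intro: subring_UR_closed[OF M(1)])
      then show ?thesis
        unfolding coeff_pderiv using f(2) subring_UR_closed(6)[OF M(1)] by metis
    qed
    moreover have "pderiv f \<noteq> 0" using deg0 by (simp add: pderiv_eq_0_iff)
    ultimately have "Polynomial.degree f \<le> Polynomial.degree (pderiv f)"
      using min * by blast
    then show False using deg0 by (simp add: degree_pderiv)
  qed
  moreover obtain h where h: "f = [:- x, 1:] * h"
    using f(3) by (auto simp: poly_eq_0_iff_dvd)
  ultimately have hx: "poly h x \<noteq> 0" by (simp add: pderiv_mult pderiv_pCons del: mult_pCons_left)
  \<comment> \<open>Otherwise \<open>f = X - x\<close>, whose constant term would put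
    \<open>x\<close> into \<open>M\<close>.\<close>
  have "Polynomial.degree h \<noteq> 0"
  proof
    assume "Polynomial.degree h = 0"
    then obtain c where c: "h = [:c:]" by (metis degree_eq_zeroE)
    then have "c = 1" using f(1) h by (auto split: if_splits)
    then have "poly.coeff f 0 = - x" using h c by simp
    then have "x \<in> M" using f(2)[of 0] subring_UR_closed(3)[OF M(1)] by fastforce
    then show False using x by simp
  qed
  then obtain x' where x': "poly h x' = 0" using root_exists[of h] by auto
  with hx have "x' \<noteq> x" by auto
  have id: "hom_graph M {(a, a) | a. a \<in> M}"
    unfolding hom_graph_def by (auto intro: subring_UR_closed[OF M(1)])
  have "fst ` {(a, a) | a. a \<in> M} = M" by force
  then have min': "Polynomial.degree f \<le> Polynomial.degree g"
    if "g \<noteq> 0" "\<And>i. poly.coeff g i \<in> fst ` {(a, a) | a. a \<in> M}" "poly g x = 0" for g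
    using that min by simp
  have "poly f x' = 0" using x' h by simp
  have "\<exists>G'. hom_graph M G' \<and> {(a, a) | a. a \<in> M} \<subseteq> G' \<and> (x, x') \<in> G'"
  proof (rule M.hom_graph_extend[OF id])
    show "(poly.coeff f i, poly.coeff f i) \<in> {(a, a) | a. a \<in> M}" for i
      using f(2) by blast
  qed (fact f \<open>poly f x' = 0\<close> min')+
  then obtain G1 where G1: "hom_graph M G1" "(x, x') \<in> G1" by blast
  from M.hom_graph_maximal[OF G1(1)] obtain G where "hom_graph M G" "G1 \<subseteq> G" "fst ` G = UNIV" .
  with G1 have G: "hom_graph M G" "(x, x') \<in> G" "fst ` G = UNIV" by (simp_all add: subsetD)
  note GD = hom_graphD[OF G(1)] and GU = hom_graph_unique[OF G(1)]
  have "\<exists>y. (a, y) \<in> G" for a using G(3) by (metis UNIV_I imageE prod.collapse)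
  then obtain \<phi> where \<phi>: "\<And>a. (a, \<phi> a) \<in> G" by metis
  have fix_M: "\<phi> a = a" if "a \<in> M" for a using GU[OF \<phi>] GD(1) that by blast
  have add: "\<phi> (a + b) = \<phi> a + \<phi> b" and diff: "\<phi> (a - b) = \<phi> a - \<phi> b"
    and mult: "\<phi> (a * b) = \<phi> a * \<phi> b" for a b
    using GU[OF \<phi>] GD(2-4)[OF \<phi> \<phi>] by blast+
  have one: "\<phi> 1 = 1" and zero: "\<phi> 0 = 0"
    using fix_M subring_UR_closed[OF M(1)] by auto
  have "inj \<phi>"
  proof (rule injI)
    fix a b assume "\<phi> a = \<phi> b"
    then have "\<phi> (a - b) = 0" by (simp add: diff)
    then have "\<phi> ((a - b) * inverse (a - b)) = 0" by (simp only: mult) simp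
    then show "a = b" using one by (cases "a = b") auto
  qed
  \<comment> \<open>An element \<open>b\<close> is a root of some \<open>g\<close> over
    \<open>k\<close>; the injective \<open>\<phi>\<close> maps the finite root set of
    \<open>g\<close> into itself, hence onto itself.\<close>
  moreover have "surj \<phi>"
  proof -
    have "b \<in> range \<phi>" for b
    proof -
      obtain g where g: "g \<noteq> 0" "\<And>i. poly.coeff g i \<in> k" "poly g b = 0"
        using algebraic by blast
      let ?Z = "{a. poly g a = 0}"
      have pow: "\<phi> (a ^ n) = \<phi> a ^ n" for a n by (induction n) (simp_all add: one mult)
      have sum: "\<phi> (\<Sum>i\<in>I. c i) = (\<Sum>i\<in>I. \<phi> (c i))" for c and I :: "nat set"
        by (induction I rule: infinite_finite_induct) (simp_all add: zero add)
      have hom: "\<phi> (poly g a) = poly g (\<phi> a)" for a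
        using g(2) M(2) fix_M unfolding poly_altdef
        by (simp add: sum mult pow subset_iff)
      then have "\<phi> ` ?Z \<subseteq> ?Z" using zero by (auto simp: hom[symmetric])
      then have "\<phi> ` ?Z = ?Z"
        using \<open>inj \<phi>\<close> poly_roots_finite[OF g(1)]
        by (intro card_subset_eq) (auto simp: card_image inj_on_def)
      then show ?thesis using g(3) by blast
    qed
    then show ?thesis by auto
  qed
  ultimately have "\<phi> \<in> ring_iso UR UR"
    by (auto simp: ring_iso_def ring_hom_def bij_betw_def add mult one)
  moreover have "\<phi> x \<noteq> x" using GU[OF \<phi> G(2)] \<open>x' \<noteq> x\<close> by simp
  ultimately show ?thesis using that fix_M by blast
qed

end

section \<open>Uniqueness of the extended absolute value\<close>

text \<open>List polynomials of HOL-Algebra start with the leading coefficient, those of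
  \<open>Poly\<close> with the constant term.\<close>

lemma UR_eval: "ring.eval UR p x = poly (Poly (rev p)) (x :: 'c::field)"
proof -
  interpret ring "UR :: 'c ring" by (rule ring_from_type_algebra)
  show ?thesis by (induction p) (simp_all add: Poly_append poly_monom mult.commute)
qed

lemma algebraic_subfield_of_algebraic_closure:
  assumes "algebraic_closure UR (k :: 'a::field_char_0 set)"
  shows "algebraic_subfield k"
proof (rule algebraic_subfield.intro)
  interpret K: algebraic_closure UR k by fact
  show k: "subfield k UR" by (rule K.subfield_axioms)
  show "\<exists>f. f \<noteq> 0 \<and> (\<forall>i. poly.coeff f i \<in> k) \<and> poly f x = 0" for x
  proof -
    obtain p where p: "p \<in> carrier (k[X]\<^bsub>UR\<^esub>)" "p \<noteq> []" "K.eval p x = 0"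
      using K.algebraicE[OF subfieldE(1)[OF k], of x] K.algebraic_extension[of x] by auto
    have pk: "set p \<subseteq> k" "hd p \<noteq> 0"
      using p(1,2) by (auto simp: univ_poly_carrier[symmetric] polynomial_def)
    have 0: "0 \<in> k" using subring_UR_closed(1) subfieldE(1)[OF k] by blast
    show ?thesis
    proof (intro exI[of _ "Poly (rev p)"] conjI allI)
      have "poly.coeff (Poly (rev p)) (length p - 1) = hd p"
        using p(2) by (simp add: nth_default_def rev_nth hd_conv_nth)
      then show "Poly (rev p) \<noteq> 0" using pk(2) by (metis coeff_0)
      show "poly.coeff (Poly (rev p)) i \<in> k" for i
      proof (cases "i < length (rev p)")
        case True
        then have "rev p ! i \<in> set (rev p)" by (rule nth_mem)
        then show ?thesis using True pk(1) by (auto simp: nth_default_def)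
      next
        case False
        then show ?thesis using 0 by (simp add: nth_default_def)
      qed
      show "poly (Poly (rev p)) x = 0" using p(3) by (simp add: UR_eval)
    qed
  qed
  show "\<exists>x. poly g x = 0" if deg: "Polynomial.degree g > 0" for g :: "'a poly"
  proof -
    define P where "P = rev (Polynomial.coeffs g)"
    have degP: "length P - 1 = Polynomial.degree g"
      by (simp add: P_def degree_eq_length_coeffs)
    have P: "P \<in> carrier (poly_ring UR)"
      using deg by (auto simp: univ_poly_def polynomial_def P_def hd_rev last_coeffs_eq_coeff_degree)
    then have "K.splitted P" using K.roots_over_carrier[of P] by simp
    then have "K.roots P \<noteq> {#}"
      unfolding K.splitted_def using deg degP by auto
    then obtain x where "x \<in># K.roots P" by blast
    then have "K.is_root P x" using K.roots_mem_iff_is_root[OF P] by auto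
    then have "poly g x = 0" by (simp add: K.is_root_def UR_eval P_def)
    then show ?thesis ..
  qed
qed

context padic_closure
begin

section \<open>Arithmetic of an ultrametric absolute value\<close>

lemma v_zero [simp]: "v 0 = 0"
  by (simp add: val_eq_0_iff)

lemma v_one [simp]: "v 1 = 1"
  using val_mult[of 1 1] val_eq_0_iff[of 1] by simp

lemma v_pos: "x \<noteq> 0 \<Longrightarrow> v x > 0"
  using val_nonneg[of x] val_eq_0_iff[of x] by linarith

lemma v_power: "v (x ^ n) = v x ^ n"
  by (induction n) (simp_all add: val_mult)

lemma v_minus [simp]: "v (- x) = v x"
proof -
  have "v (-1) * v (-1) = 1" by (simp add: val_mult[symmetric])
  then have "v (-1) = 1"
    using val_nonneg[of "-1"] by (metis abs_of_nonneg abs_square_eq_1 power2_eq_square)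
  then show ?thesis using val_mult[of "-1" x] by simp
qed

lemma v_diff: "v (x - y) \<le> max (v x) (v y)"
  using val_ultrametric[of x "- y"] by simp

lemma v_diff_commute: "v (x - y) = v (y - x)"
  using v_minus[of "x - y"] by simp

lemma v_inverse: "v (inverse x) = inverse (v x)"
proof (cases "x = 0")
  case False
  then have "v x * v (inverse x) = 1" by (simp add: val_mult[symmetric])
  then show ?thesis by (simp add: inverse_unique)
qed simp

lemma v_divide: "v (x / y) = v x / v y"
  by (simp add: divide_inverse val_mult v_inverse)

lemma v_sum_le: "(\<And>i. i \<in> I \<Longrightarrow> v (f i) \<le> B) \<Longrightarrow> 0 \<le> B \<Longrightarrow> v (sum f I) \<le> B"
proof (induction I rule: infinite_finite_induct)
  case (insert i I)
  then show ?case using val_ultrametric[of "f i" "sum f I"] by fastforce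
qed auto

lemma v_sum_less: "(\<And>i. i \<in> I \<Longrightarrow> v (f i) < B) \<Longrightarrow> 0 < B \<Longrightarrow> v (sum f I) < B"
proof (induction I rule: infinite_finite_induct)
  case (insert i I)
  then have "v (f i) < B" "v (sum f I) < B" by auto
  then show ?case using val_ultrametric[of "f i" "sum f I"] insert.hyps by simp
qed auto

lemma Metric_space_val_dist: "Metric_space S (val_dist v)"
proof (rule Metric_space.subspace)
  show "Metric_space UNIV (val_dist v)"
  proof
    fix x y z
    show "0 \<le> val_dist v x y" by (simp add: val_dist_def val_nonneg)
    show "val_dist v x y = val_dist v y x" by (simp add: val_dist_def v_diff_commute)
    show "(val_dist v x y = 0) = (x = y)" by (simp add: val_dist_def val_eq_0_iff)
    show "val_dist v x z \<le> val_dist v x y + val_dist v y z"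
      using val_ultrametric[of "x - y" "y - z"] val_nonneg[of "x - y"] val_nonneg[of "y - z"]
      by (simp add: val_dist_def)
  qed
qed simp

sublocale Qp: algebraic_subfield "Qp v"
  by (rule algebraic_subfield_of_algebraic_closure[OF algebraic_closure_Qp])

section \<open>Finite-dimensional spaces over the p-adic numbers\<close>

definition Cauchy_seq :: "(nat \<Rightarrow> 'a) \<Rightarrow> bool" where
  "Cauchy_seq s \<longleftrightarrow> (\<forall>e>0. \<exists>N. \<forall>m\<ge>N. \<forall>n\<ge>N. v (s m - s n) < e)"

definition complete_set :: "'a set \<Rightarrow> bool" where
  "complete_set W \<longleftrightarrow> (\<forall>s. range s \<subseteq> W \<longrightarrow> Cauchy_seq s \<longrightarrow> (\<exists>L\<in>W. (\<lambda>n. v (s n - L)) \<longlonglongrightarrow> 0))"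

lemma complete_set_Qp: "complete_set (Qp v)"
  unfolding complete_set_def
proof (intro allI impI)
  fix s assume s: "range s \<subseteq> Qp v" "Cauchy_seq s"
  interpret Q: Metric_space "Qp v" "val_dist v" by (rule Metric_space_val_dist)
  have "Q.MCauchy s"
    unfolding Q.MCauchy_def
  proof (intro conjI s allI impI)
    fix \<epsilon> :: real assume "\<epsilon> > 0"
    then obtain N where "\<forall>m\<ge>N. \<forall>n\<ge>N. v (s m - s n) < \<epsilon>"
      using s(2) unfolding Cauchy_seq_def by blast
    then show "\<exists>N. \<forall>n n'. N \<le> n \<longrightarrow> N \<le> n' \<longrightarrow> val_dist v (s n) (s n') < \<epsilon>"
      by (auto simp: val_dist_def intro!: exI[of _ N])
  qed
  then obtain L where "limitin Q.mtopology s L sequentially"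
    using complete_Qp Q.mcomplete_def by blast
  then have "L \<in> Qp v" "(\<lambda>n. v (s n - L)) \<longlonglongrightarrow> 0"
    by (auto simp: Q.limitin_metric val_dist_def tendsto_iff val_nonneg eventually_conj_iff)
  then show "\<exists>L\<in>Qp v. (\<lambda>n. v (s n - L)) \<longlonglongrightarrow> 0" by blast
qed

definition Qp_subspace :: "'a set \<Rightarrow> bool" where
  "Qp_subspace W \<longleftrightarrow> 0 \<in> W \<and> (\<forall>x\<in>W. \<forall>y\<in>W. x + y \<in> W) \<and> (\<forall>a\<in>Qp v. \<forall>x\<in>W. a * x \<in> W)"

lemma Qp_subspaceD:
  assumes "Qp_subspace W"
  shows "0 \<in> W" "x \<in> W \<Longrightarrow> y \<in> W \<Longrightarrow> x + y \<in> W" "a \<in> Qp v \<Longrightarrow> x \<in> W \<Longrightarrow> a * x \<in> W"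
    "x \<in> W \<Longrightarrow> - x \<in> W" "x \<in> W \<Longrightarrow> y \<in> W \<Longrightarrow> x - y \<in> W"
proof -
  show W: "0 \<in> W" "x \<in> W \<Longrightarrow> y \<in> W \<Longrightarrow> x + y \<in> W" "a \<in> Qp v \<Longrightarrow> x \<in> W \<Longrightarrow> a * x \<in> W" for x y a
    using assms by (auto simp: Qp_subspace_def)
  have "-1 \<in> Qp v" using subring_UR_closed[OF Qp.subring_k] by blast
  then show m: "x \<in> W \<Longrightarrow> - x \<in> W" for x using W(3)[of "-1" x] by simp
  show "x \<in> W \<Longrightarrow> y \<in> W \<Longrightarrow> x - y \<in> W" using W(2)[of x "- y"] m[of y] by simp
qed

text \<open>A complete set is closed: points of \<open>W\<close> approaching \<open>e\<close> would
  form a Cauchy sequence, whose limit in \<open>W\<close> could only be \<open>e\<close>.\<close>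

lemma complete_set_dist_pos:
  assumes W: "complete_set W" and e: "e \<notin> W"
  obtains \<delta> where "\<delta> > 0" "\<And>w. w \<in> W \<Longrightarrow> v (e - w) \<ge> \<delta>"
proof -
  have "\<exists>\<delta>>0. \<forall>w\<in>W. v (e - w) \<ge> \<delta>"
  proof (rule ccontr)
    assume "\<not> ?thesis"
    then have far: "\<exists>w\<in>W. v (e - w) < \<delta>" if "\<delta> > 0" for \<delta>
      using that by (meson not_le)
    have "\<exists>w\<in>W. v (e - w) < inverse (real (Suc n))" for n
      by (rule far) simp
    then obtain s where s: "\<And>n. s n \<in> W" "\<And>n. v (e - s n) < inverse (real (Suc n))" by metis
    have lim: "(\<lambda>n. v (e - s n)) \<longlonglongrightarrow> 0"
      by (rule tendsto_sandwich[OF _ _ tendsto_const LIMSEQ_inverse_real_of_nat])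
        (use s(2) in \<open>auto intro!: always_eventually less_imp_le val_nonneg\<close>)
    have "Cauchy_seq s"
      unfolding Cauchy_seq_def
    proof (intro allI impI)
      fix \<epsilon> :: real assume "\<epsilon> > 0"
      with lim obtain N where N: "\<And>n. n \<ge> N \<Longrightarrow> v (e - s n) < \<epsilon>"
        by (auto simp: tendsto_iff eventually_sequentially val_nonneg)
      have "v (s m - s n) < \<epsilon>" if "m \<ge> N" "n \<ge> N" for m n
        using v_diff[of "e - s n" "e - s m"] N[OF that(1)] N[OF that(2)] by simp
      then show "\<exists>N. \<forall>m\<ge>N. \<forall>n\<ge>N. v (s m - s n) < \<epsilon>" by blast
    qed
    then obtain L where L: "L \<in> W" "(\<lambda>n. v (s n - L)) \<longlonglongrightarrow> 0"
      using W s(1) unfolding complete_set_def by blast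
    have "v (e - L) \<le> v (e - s n) + v (s n - L)" for n
      using val_ultrametric[of "e - s n" "s n - L"] val_nonneg[of "e - s n"] val_nonneg[of "s n - L"]
      by simp
    then have "v (e - L) \<le> 0"
      using tendsto_add[OF lim L(2)] by (intro LIMSEQ_le_const) auto
    then have "e = L" using val_nonneg[of "e - L"] val_eq_0_iff[of "e - L"] by simp
    then show False using L(1) e by simp
  qed
  then show ?thesis using that by blast
qed

text \<open>Inductive step, one dimension at a time, of the equivalence of norms on
  finite-dimensional spaces over a complete field. If \<open>e\<close> lies outside
  \<open>W\<close>, its positive distance from \<open>W\<close> bounds the coordinate
  \<open>a\<close> of \<open>w + a * e\<close>; hence both coordinates of a Cauchy sequence are
  Cauchy, and bounds on \<open>W\<close> pass to \<open>W'\<close>.\<close>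

lemma complete_bounded_extend:
  assumes W: "Qp_subspace W" "complete_set W"
    and u: "\<And>x y. u (x + y) \<le> max (u x) (u y)" "\<And>x y. u (x * y) = u x * u y"
      "\<And>a. a \<in> Qp v \<Longrightarrow> u a = v a" "\<And>x. u x \<ge> (0::real)"
    and C: "\<And>w. w \<in> W \<Longrightarrow> u w \<le> C * v w"
    and W': "W' = {w + a * e | w a. w \<in> W \<and> a \<in> Qp v}"
  shows "Qp_subspace W' \<and> complete_set W' \<and> (\<exists>C'. \<forall>w\<in>W'. u w \<le> C' * v w)"
proof (cases "e \<in> W")
  case True
  note WD = Qp_subspaceD[OF W(1)]
  have "W' = W"
  proof
    show "W' \<subseteq> W" using True by (auto simp: W' intro: WD)
    show "W \<subseteq> W'"
    proof
      fix w assume "w \<in> W"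
      then have "w = w + 0 * e" "0 \<in> Qp v" using subring_UR_closed(1)[OF Qp.subring_k] by auto
      then show "w \<in> W'" using \<open>w \<in> W\<close> unfolding W' by blast
    qed
  qed
  then show ?thesis using W C by blast
next
  case False
  note WD = Qp_subspaceD[OF W(1)] and QD = subring_UR_closed[OF Qp.subring_k]
  obtain \<delta> where \<delta>: "\<delta> > 0" "\<And>w. w \<in> W \<Longrightarrow> v (e - w) \<ge> \<delta>"
    using complete_set_dist_pos[OF W(2) False] by blast
  \<comment> \<open>For nonzero \<open>a\<close>, the vector is \<open>a\<close> times the
    difference of \<open>e\<close> and the element \<open>- w / a\<close> of
    \<open>W\<close>.\<close>
  have coeff_le: "\<delta> * v a \<le> v (w + a * e)" if "w \<in> W" "a \<in> Qp v" for w a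
  proof (cases "a = 0")
    case True
    then show ?thesis by (simp add: val_nonneg)
  next
    case False
    define w' where "w' = - (inverse a * w)"
    have "w' \<in> W"
      unfolding w'_def using that by (intro WD subfield_UR_inverse[OF Qp.subfield])
    then have "\<delta> * v a \<le> v (e - w') * v a" using \<delta> by (simp add: mult_right_mono val_nonneg)
    also have "\<dots> = v ((e - w') * a)" by (simp add: val_mult)
    also have "(e - w') * a = w + a * e" using False by (simp add: w'_def field_simps)
    finally show ?thesis .
  qed
  have W'I: "w + a * e \<in> W'" if "w \<in> W" "a \<in> Qp v" for w a
    using that unfolding W' by blast
  have "Qp_subspace W'"
    unfolding Qp_subspace_def
  proof (intro conjI ballI)
    show "0 \<in> W'" using W'I[OF WD(1) QD(1)] by simp
  next
    fix x y assume "x \<in> W'" "y \<in> W'"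
    then obtain w a w' a' where *: "x = w + a * e" "y = w' + a' * e" "w \<in> W" "w' \<in> W" "a \<in> Qp v" "a' \<in> Qp v"
      unfolding W' by blast
    then have "x + y = (w + w') + (a + a') * e" by (simp add: algebra_simps)
    then show "x + y \<in> W'" using W'I[OF WD(2)[OF *(3,4)] QD(4)[OF *(5,6)]] by simp
  next
    fix c x assume c: "c \<in> Qp v" and "x \<in> W'"
    then obtain w a where *: "x = w + a * e" "w \<in> W" "a \<in> Qp v"
      unfolding W' by blast
    then have "c * x = c * w + (c * a) * e" by (simp add: algebra_simps)
    then show "c * x \<in> W'" using W'I[OF WD(3)[OF c *(2)] QD(6)[OF c *(3)]] by simp
  qed
  moreover have "complete_set W'"
    unfolding complete_set_def
  proof (intro allI impI)
    fix s assume s: "range s \<subseteq> W'" "Cauchy_seq s"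
    then have "\<exists>w a. w \<in> W \<and> a \<in> Qp v \<and> s n = w + a * e" for n
      unfolding W' by blast
    then obtain w a where wa: "\<And>n. w n \<in> W" "\<And>n. a n \<in> Qp v" "\<And>n. s n = w n + a n * e" by metis
    have a_le: "\<delta> * v (a m - a n) \<le> v (s m - s n)" for m n
    proof -
      have "s m - s n = (w m - w n) + (a m - a n) * e" by (simp add: wa algebra_simps)
      then show ?thesis using coeff_le[OF WD(5)[OF wa(1) wa(1)] QD(5)[OF wa(2) wa(2)]] by metis
    qed
    have ca: "Cauchy_seq a"
      unfolding Cauchy_seq_def
    proof (intro allI impI)
      fix \<epsilon> :: real assume "\<epsilon> > 0"
      then have "\<delta> * \<epsilon> > 0" using \<delta> by simp
      then obtain N where "\<forall>m\<ge>N. \<forall>n\<ge>N. v (s m - s n) < \<delta> * \<epsilon>"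
        using s(2) unfolding Cauchy_seq_def by blast
      then have "\<forall>m\<ge>N. \<forall>n\<ge>N. \<delta> * v (a m - a n) < \<delta> * \<epsilon>"
        using a_le by (meson le_less_trans)
      then show "\<exists>N. \<forall>m\<ge>N. \<forall>n\<ge>N. v (a m - a n) < \<epsilon>" using \<delta> by auto
    qed
    have "Cauchy_seq w"
      unfolding Cauchy_seq_def
    proof (intro allI impI)
      fix \<epsilon> :: real assume \<epsilon>: "\<epsilon> > 0"
      have e1: "v e + 1 > 0" using val_nonneg[of e] by linarith
      then have "\<epsilon> / (v e + 1) > 0" using \<epsilon> by simp
      then obtain N1 where N1: "\<forall>m\<ge>N1. \<forall>n\<ge>N1. v (a m - a n) < \<epsilon> / (v e + 1)"
        using ca unfolding Cauchy_seq_def by blast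
      obtain N2 where N2: "\<forall>m\<ge>N2. \<forall>n\<ge>N2. v (s m - s n) < \<epsilon>"
        using s(2) \<epsilon> unfolding Cauchy_seq_def by blast
      have "v (w m - w n) < \<epsilon>" if "m \<ge> max N1 N2" "n \<ge> max N1 N2" for m n
      proof -
        have "v ((a m - a n) * e) \<le> v (a m - a n) * (v e + 1)"
          by (simp add: val_mult mult_left_mono val_nonneg)
        also have "\<dots> < \<epsilon>" using N1 that e1 by (simp add: pos_less_divide_eq)
        finally have "v ((a m - a n) * e) < \<epsilon>" .
        moreover have "v (s m - s n) < \<epsilon>" using N2 that by simp
        moreover have "w m - w n = (s m - s n) - (a m - a n) * e" by (simp add: wa algebra_simps)
        ultimately show ?thesis using v_diff[of "s m - s n" "(a m - a n) * e"] by simp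
      qed
      then show "\<exists>N. \<forall>m\<ge>N. \<forall>n\<ge>N. v (w m - w n) < \<epsilon>" by blast
    qed
    then obtain L where L: "L \<in> W" "(\<lambda>n. v (w n - L)) \<longlonglongrightarrow> 0"
      using W(2) wa(1) unfolding complete_set_def by blast
    obtain A where A: "A \<in> Qp v" "(\<lambda>n. v (a n - A)) \<longlonglongrightarrow> 0"
      using ca wa(2) complete_set_Qp unfolding complete_set_def by blast
    have "(\<lambda>n. v (w n - L) + v (a n - A) * v e) \<longlonglongrightarrow> 0 + 0 * v e"
      by (intro tendsto_intros L A)
    then have lim: "(\<lambda>n. v (w n - L) + v (a n - A) * v e) \<longlonglongrightarrow> 0" by simp
    have "v (s n - (L + A * e)) \<le> v (w n - L) + v (a n - A) * v e" for n
    proof -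
      have *: "s n - (L + A * e) = (w n - L) + (a n - A) * e" by (simp add: wa algebra_simps)
      show ?thesis
        unfolding * using val_ultrametric[of "w n - L" "(a n - A) * e"] val_nonneg[of "w n - L"]
          val_nonneg[of "(a n - A) * e"] by (simp add: val_mult)
    qed
    then have "(\<lambda>n. v (s n - (L + A * e))) \<longlonglongrightarrow> 0"
      by (intro tendsto_sandwich[OF _ _ tendsto_const lim])
        (auto intro!: always_eventually val_nonneg)
    moreover have "L + A * e \<in> W'" using L A unfolding W' by blast
    ultimately show "\<exists>L\<in>W'. (\<lambda>n. v (s n - L)) \<longlonglongrightarrow> 0" by blast
  qed
  moreover have "\<exists>C'. \<forall>x\<in>W'. u x \<le> C' * v x"
  proof (intro exI ballI)
    fix x assume "x \<in> W'"
    then obtain w a where *: "x = w + a * e" "w \<in> W" "a \<in> Qp v"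
      unfolding W' by blast
    \<comment> \<open>Combine \<open>v w \<le> v x + v a * v e\<close> with
      \<open>v a \<le> v x / \<delta>\<close>. Below, \<open>\<bar>C\<bar>\<close> appears since
      \<open>C\<close> may be negative.\<close>
    define D where "D = 1 + v e / \<delta>"
    have D: "D \<ge> 1" using \<delta> by (simp add: D_def val_nonneg)
    have va: "v a \<le> v x / \<delta>" using coeff_le[of w a] * \<delta> by (simp add: field_simps)
    have "v w \<le> v x + v (a * e)"
      using v_diff[of x "a * e"] val_nonneg[of x] val_nonneg[of "a * e"] * by simp
    also have "\<dots> \<le> v x + v x / \<delta> * v e"
      using mult_right_mono[OF va val_nonneg[of e]] by (simp add: val_mult)
    finally have vw: "v w \<le> D * v x" by (simp add: D_def algebra_simps)
    have "u w \<le> \<bar>C\<bar> * v w"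
      using C[OF *(2)] mult_right_mono[OF abs_ge_self[of C] val_nonneg[of w]] by linarith
    also have "\<dots> \<le> \<bar>C\<bar> * (D * v x)" using vw by (simp add: mult_left_mono)
    finally have 1: "u w \<le> \<bar>C\<bar> * D * v x" by simp
    have 2: "u (a * e) \<le> u e / \<delta> * v x"
      using mult_right_mono[OF va u(4)[of e]] * by (simp add: u(2,3) field_simps)
    show "u x \<le> (\<bar>C\<bar> * D + u e / \<delta>) * v x"
      using u(1)[of w "a * e"] u(4)[of w] u(4)[of "a * e"] 1 2 *(1) by (simp add: algebra_simps)
  qed
  ultimately show ?thesis by blast
qed

text \<open>A multiplicative ultrametric function agreeing with \<open>v\<close> on the \<open>p\<close>-adic numbers is bounded by a
  multiple of \<open>v\<close> on the finite-dimensional algebra generated by \<open>y\<close>; applied to the powers of \<open>y\<close>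
  this removes the constant.\<close>
lemma multiplicative_le_val:
  assumes u: "\<And>x y. u (x + y) \<le> max (u x) (u y)" "\<And>x y. u (x * y) = u x * u y"
      "\<And>a. a \<in> Qp v \<Longrightarrow> u a = v a" "\<And>x. u x \<ge> (0::real)"
  shows "u y \<le> v y"
proof -
  note QD = subring_UR_closed[OF Qp.subring_k]
  \<comment> \<open>The span of the first \<open>n\<close> powers of \<open>y\<close>, grown by one
    generator at a time; for \<open>n\<close> the degree of \<open>y\<close> it is the algebra
    generated by \<open>y\<close>.\<close>
  define W where "W n = {\<Sum>i<n. a i * y ^ i | a. \<forall>i. a i \<in> Qp v}" for n :: nat
  have W_Suc: "W (Suc n) = {w + a * y ^ n | w a. w \<in> W n \<and> a \<in> Qp v}" for n
  proof (intro equalityI subsetI)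
    fix z assume "z \<in> W (Suc n)"
    then show "z \<in> {w + a * y ^ n | w a. w \<in> W n \<and> a \<in> Qp v}"
      unfolding W_def by auto
  next
    fix z assume "z \<in> {w + a * y ^ n | w a. w \<in> W n \<and> a \<in> Qp v}"
    then obtain b a where *: "\<forall>i. b i \<in> Qp v" "a \<in> Qp v" "z = (\<Sum>i<n. b i * y ^ i) + a * y ^ n"
      unfolding W_def by blast
    then have "z = (\<Sum>i<Suc n. (b(n := a)) i * y ^ i)" by simp
    moreover have "\<forall>i. (b(n := a)) i \<in> Qp v" using * by simp
    ultimately show "z \<in> W (Suc n)" unfolding W_def by blast
  qed
  have good: "Qp_subspace (W n) \<and> complete_set (W n) \<and> (\<exists>C. \<forall>w\<in>W n. u w \<le> C * v w)" for n
  proof (induction n)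
    case 0
    have "W 0 = {0}" using QD(1) by (auto simp: W_def)
    moreover have "complete_set {0}" unfolding complete_set_def by (auto simp: image_subset_iff)
    ultimately show ?case
      using u(3)[OF QD(1)] by (auto simp: Qp_subspace_def intro!: exI[of _ 1])
  next
    case (Suc n)
    then obtain C where "\<And>w. w \<in> W n \<Longrightarrow> u w \<le> C * v w"
      and "Qp_subspace (W n)" "complete_set (W n)" by blast
    then show ?case
      using u by (intro complete_bounded_extend[where W = "W n" and e = "y ^ n" and u = u and C = C] W_Suc)
  qed
  obtain f where f: "Polynomial.lead_coeff f = 1" "\<And>i. poly.coeff f i \<in> Qp v" "poly f y = 0"
    using Qp.minimal_polynomial_exists[OF Qp.subring_k order_refl, of y] by metis
  define n where "n = Polynomial.degree f"
  note WD = Qp_subspaceD[OF good[THEN conjunct1]]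
  have "(\<Sum>i<n. poly.coeff f i * y ^ i) + y ^ n = 0"
    using f(1,3) by (simp add: poly_altdef n_def lessThan_Suc_atMost[symmetric])
  then have "y ^ n = - (\<Sum>i<n. poly.coeff f i * y ^ i)" by (simp add: eq_neg_iff_add_eq_0 add.commute)
  moreover have "(\<Sum>i<n. poly.coeff f i * y ^ i) \<in> W n" unfolding W_def using f(2) by blast
  \<comment> \<open>The monic relation for \<open>y\<close> makes \<open>W n\<close> stable under
    multiplication by \<open>y\<close>, so all powers of \<open>y\<close> lie in it and share one
    constant \<open>C\<close>.\<close>
  ultimately have yn: "y ^ n \<in> W n" using WD(4) by simp
  have "n \<noteq> 0"
  proof
    assume "n = 0"
    then obtain c where "f = [:c:]" unfolding n_def by (metis degree_eq_zeroE)
    then show False using f by simp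
  qed
  have mult_y: "y * w \<in> W n" if w: "w \<in> W n" for w
  proof -
    obtain a where a: "\<forall>i. a i \<in> Qp v" "w = (\<Sum>i<n. a i * y ^ i)" using w unfolding W_def by blast
    obtain m where m: "n = Suc m" using \<open>n \<noteq> 0\<close> by (cases n) auto
    \<comment> \<open>Multiplication by \<open>y\<close> shifts the coefficients; the last one
      overflows into the multiple \<open>a m\<close> of \<open>y ^ n\<close>.\<close>
    define b where "b i = (case i of 0 \<Rightarrow> 0 | Suc j \<Rightarrow> a j)" for i
    have "y * w = (\<Sum>i<n. b i * y ^ i) + a m * y ^ n"
    proof -
      have "(\<Sum>i<n. b i * y ^ i) = (\<Sum>i<m. a i * y ^ Suc i)"
        unfolding m sum.lessThan_Suc_shift by (simp add: b_def)
      moreover have "y * w = (\<Sum>i<n. a i * y ^ Suc i)"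
        unfolding a(2) sum_distrib_left by (simp add: algebra_simps)
      ultimately show ?thesis by (simp add: m)
    qed
    moreover have "(\<Sum>i<n. b i * y ^ i) \<in> W n"
      unfolding W_def using a(1) QD(1) by (auto simp: b_def split: nat.split)
    ultimately show ?thesis using WD(2,3) yn a(1) by simp
  qed
  have y_pow: "y ^ j \<in> W n" for j
  proof (induction j)
    case 0
    have "(\<Sum>i<n. (if i = 0 then 1 else 0) * y ^ i) = 1"
      using \<open>n \<noteq> 0\<close> by (simp add: if_distrib[of "\<lambda>c. c * _"] cong: if_cong)
    then show ?case unfolding W_def using QD(1,2) by (auto intro!: exI[of _ "\<lambda>i. if i = 0 then 1 else 0"])
  next
    case (Suc j)
    then show ?case using mult_y by simp
  qed
  obtain C where C: "\<And>w. w \<in> W n \<Longrightarrow> u w \<le> C * v w" using good by blast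
  have u_pow: "u (y ^ j) = u y ^ j" for j
    by (induction j) (use u(3)[OF QD(2)] in \<open>simp_all add: u(2)\<close>)
  have le: "u y ^ j \<le> C * v y ^ j" for j
    using C[OF y_pow[of j]] by (simp add: u_pow v_power)
  show ?thesis
  proof (rule ccontr)
    assume "\<not> ?thesis"
    then have lt: "v y < u y" by simp
    show False
    proof (cases "y = 0")
      case True
      then show False using lt u(3)[OF QD(1)] by simp
    next
      case False
      then have "v y > 0" by (rule v_pos)
      then have "1 < u y / v y" using lt by simp
      then obtain j where "C < (u y / v y) ^ j" using real_arch_pow by blast
      then show False using le[of j] \<open>v y > 0\<close> by (simp add: power_divide field_simps)
    qed
  qed
qed

text \<open>The function \<open>v \<circ> g\<close> is multiplicative, ultrametric and equal to
  \<open>v\<close> on the p-adic numbers, so \<open>multiplicative_le_val\<close> bounds it by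
  \<open>v\<close>. The same bound at \<open>inverse y\<close> gives the opposite
  inequality.\<close>

lemma val_ring_hom_invariant:
  assumes g: "g \<in> ring_iso UR UR" "\<And>a. a \<in> Qp v \<Longrightarrow> g a = a"
  shows "v (g y) = v y"
proof -
  have hom: "g (a + b) = g a + g b" "g (a * b) = g a * g b" for a b
    using g(1) by (auto simp: ring_iso_def ring_hom_def)
  have le: "v (g y) \<le> v y" for y
    using multiplicative_le_val[of "\<lambda>x. v (g x)" y] g(2)
    by (simp add: hom val_ultrametric val_mult val_nonneg)
  show ?thesis
  proof (cases "y = 0")
    case True
    then show ?thesis using le[of 0] val_nonneg[of "g 0"] by simp
  next
    case False
    have "g 1 = 1" using g(2) subring_UR_closed(2)[OF Qp.subring_k] by blast
    then have "g y * g (inverse y) = 1" using False by (simp add: hom(2)[symmetric])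
    then have "g (inverse y) = inverse (g y)" by (simp add: inverse_unique)
    then have "inverse (v (g y)) \<le> inverse (v y)" using le[of "inverse y"] by (simp add: v_inverse)
    moreover have "g y \<noteq> 0" using \<open>g y * g (inverse y) = 1\<close> by auto
    ultimately have "v y \<le> v (g y)" using v_pos by (simp add: False)
    then show ?thesis using le[of y] by simp
  qed
qed

subsection \<open>Inertia and ramification\<close>

text \<open>A monic \<open>f\<close> is a product of factors \<open>X - r\<close>; if its value at
  \<open>x\<close> is less than 1 in absolute value, so is one of the factors.\<close>

lemma monic_near_root:
  assumes "Polynomial.lead_coeff f = 1" "v (poly f x) < 1"
  obtains r where "poly f r = 0" "v (x - r) < 1"
proof -
  have "\<exists>r. poly f r = 0 \<and> v (x - r) < 1"
    using assms
  proof (induction "Polynomial.degree f" arbitrary: f rule: less_induct)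
    case less
    show ?case
    proof (cases "Polynomial.degree f = 0")
      case True
      then obtain c where "f = [:c:]" by (metis degree_eq_zeroE)
      then show ?thesis using less.prems by simp
    next
      case False
      then obtain r where r: "poly f r = 0" using Qp.root_exists by blast
      then obtain h where h: "f = [:- r, 1:] * h" by (auto simp: poly_eq_0_iff_dvd)
      show ?thesis
      proof (cases "v (x - r) < 1")
        case True
        then show ?thesis using r by blast
      next
        case False
        have "h \<noteq> 0" using h less.prems by auto
        then have deg: "Polynomial.degree h < Polynomial.degree f"
          unfolding h by (subst degree_mult_eq) auto
        have lead: "Polynomial.lead_coeff h = 1"
          using less.prems(1) unfolding h lead_coeff_mult by simp
        have "v (x - r) * v (poly h x) < 1"
          using less.prems(2) by (simp add: h val_mult[symmetric] algebra_simps)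
        then have "v (poly h x) < 1"
          using False mult_right_mono[of 1 "v (x - r)" "v (poly h x)"] val_nonneg[of "poly h x"]
          by simp
        then obtain r' where "poly h r' = 0" "v (x - r') < 1" using less.hyps deg lead by blast
        then show ?thesis using h by auto
      qed
    qed
  qed
  then show ?thesis using that by blast
qed

section \<open>Integral polynomials and their behaviour on residue classes\<close>

lemma v_poly_le:
  assumes "\<And>i. v (poly.coeff h i) \<le> 1" "v x \<le> 1"
  shows "v (poly h x) \<le> 1"
  unfolding poly_altdef
proof (rule v_sum_le)
  fix i
  show "v (poly.coeff h i * x ^ i) \<le> 1"
    using assms by (simp add: val_mult v_power mult_le_one power_le_one val_nonneg)
qed simp

lemma v_poly_diff_less:
  assumes "\<And>i. v (poly.coeff h i) \<le> 1" "v x \<le> 1" "v (x - r) < 1"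
  shows "v (poly h x - poly h r) < 1"
proof -
  have r: "v r \<le> 1" using v_diff[of x "x - r"] assms by simp
  have "v (x ^ i - r ^ i) < 1" for i
  proof -
    have "v (\<Sum>j<i. r ^ (i - Suc j) * x ^ j) \<le> 1"
      using assms(2) r
      by (intro v_sum_le) (simp_all add: val_mult v_power mult_le_one power_le_one val_nonneg)
    then have "v (x - r) * v (\<Sum>j<i. r ^ (i - Suc j) * x ^ j) < 1"
      using assms(3) mult_left_le[OF _ val_nonneg[of "x - r"]] by fastforce
    then show ?thesis by (simp add: power_diff_sumr2 val_mult)
  qed
  then have "v (poly.coeff h i * (x ^ i - r ^ i)) < 1" for i
    using assms(1)[of i] mult_right_mono[OF assms(1)[of i] val_nonneg[of "x ^ i - r ^ i"]]
    by (simp add: val_mult le_less_trans)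
  then have "v (\<Sum>i\<le>Polynomial.degree h. poly.coeff h i * (x ^ i - r ^ i)) < 1"
    by (intro v_sum_less) auto
  then show ?thesis by (simp add: poly_altdef sum_subtractf algebra_simps)
qed

text \<open>Leading terms with coefficient of absolute value below 1 vanish modulo the maximal ideal
  and are dropped; the unit coefficient \<open>j\<close> stops this process. The resulting leading
  coefficient is a unit and can be divided out.\<close>

lemma monic_of_unit_coeff:
  assumes M: "subring M UR" "Qp v \<subseteq> M" and x: "v x \<le> 1"
    and h: "\<And>i. poly.coeff h i \<in> M" "\<And>i. v (poly.coeff h i) \<le> 1" "v (poly.coeff h j) = 1"
      "v (poly h x) < 1"
  obtains f where "Polynomial.lead_coeff f = 1" "\<And>i. poly.coeff f i \<in> M"
    "\<And>i. v (poly.coeff f i) \<le> 1" "v (poly f x) < 1" "Polynomial.degree f \<le> Polynomial.degree h"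
proof -
  have "\<exists>f. Polynomial.lead_coeff f = 1 \<and> (\<forall>i. poly.coeff f i \<in> M) \<and>
    (\<forall>i. v (poly.coeff f i) \<le> 1) \<and> v (poly f x) < 1 \<and> Polynomial.degree f \<le> Polynomial.degree h"
    using h
  proof (induction "Polynomial.degree h" arbitrary: h rule: less_induct)
    case less
    define c where "c = Polynomial.lead_coeff h"
    have "h \<noteq> 0" using less.prems(3) by auto
    then have "c \<noteq> 0" by (simp add: c_def)
    have cM: "c \<in> M" using less.prems by (simp add: c_def)
    show ?case
    proof (cases "v c = 1")
      case True
      let ?f = "Polynomial.smult (inverse c) h"
      have "Polynomial.lead_coeff ?f = 1" using \<open>c \<noteq> 0\<close> by (simp add: c_def)
      moreover have "\<forall>i. poly.coeff ?f i \<in> M"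
        using less.prems(1) Qp.inverse_in_overring[OF M cM] subring_UR_closed(6)[OF M(1)] by simp
      moreover have "\<forall>i. v (poly.coeff ?f i) \<le> 1" "v (poly ?f x) < 1"
        using less.prems True by (simp_all add: val_mult v_inverse)
      ultimately show ?thesis by (intro exI[of _ ?f]) simp
    next
      case False
      then have vc: "v c < 1" using less.prems(2)[of "Polynomial.degree h"] by (simp add: c_def)
      define m where "m = Polynomial.monom c (Polynomial.degree h)"
      have cm: "poly.coeff (h - m) i = (if i = Polynomial.degree h then 0 else poly.coeff h i)" for i
        unfolding m_def c_def coeff_diff coeff_monom by (cases "i = Polynomial.degree h") simp_all
      \<comment> \<open>The unit coefficient survives the removal of the leading term, which also
        keeps the polynomial nonzero.\<close>
      have j: "j \<noteq> Polynomial.degree h" using vc less.prems(3) by (auto simp: c_def)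
      have "h - m \<noteq> 0" using cm[of j] j less.prems(3) by auto
      moreover have "Polynomial.degree (h - m) \<le> Polynomial.degree h"
        unfolding m_def by (intro degree_diff_le degree_monom_le) auto
      moreover have "poly.coeff (h - m) (Polynomial.degree h) = 0" unfolding cm by simp
      ultimately have deg: "Polynomial.degree (h - m) < Polynomial.degree h"
        using eq_zero_or_degree_less by blast
      have "v (poly m x) < 1"
        using vc x mult_left_mono[OF power_le_one[OF val_nonneg[of x] x, of "Polynomial.degree h"] val_nonneg[of c]]
        by (simp add: m_def poly_monom val_mult v_power)
      then have "v (poly (h - m) x) < 1"
        using v_diff[of "poly h x" "poly m x"] less.prems(4) by simp
      moreover have "poly.coeff (h - m) i \<in> M" "v (poly.coeff (h - m) i) \<le> 1" for i
        using less.prems(1,2)[of i] subring_UR_closed(1)[OF M(1)] by (simp_all only: cm) auto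
      moreover have "v (poly.coeff (h - m) j) = 1" unfolding cm using less.prems(3) j by simp
      ultimately show ?thesis using less.hyps[OF deg] deg by (meson less_imp_le order_trans)
    qed
  qed
  then show ?thesis using that by blast
qed

text \<open>Division by a coefficient \<open>c\<close> of largest absolute value makes the Gauss
  norm 1.\<close>

lemma poly_normalize:
  assumes M: "subring M UR" "Qp v \<subseteq> M" and h: "h \<noteq> 0" "\<And>i. poly.coeff h i \<in> M"
  obtains c j where "c \<in> M" "c \<noteq> 0" "\<And>i. poly.coeff (Polynomial.smult (inverse c) h) i \<in> M"
    "\<And>i. v (poly.coeff (Polynomial.smult (inverse c) h) i) \<le> 1"
    "v (poly.coeff (Polynomial.smult (inverse c) h) j) = 1"
proof -
  define B where "B = Max ((\<lambda>i. v (poly.coeff h i)) ` {..Polynomial.degree h})"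
  have le: "v (poly.coeff h i) \<le> B" if "i \<le> Polynomial.degree h" for i
    unfolding B_def using that by (intro Max_ge) auto
  have "B \<in> (\<lambda>i. v (poly.coeff h i)) ` {..Polynomial.degree h}"
    unfolding B_def by (intro Max_in) auto
  then obtain j where j: "v (poly.coeff h j) = B" by auto
  have "0 < v (Polynomial.lead_coeff h)" using h by (intro v_pos) simp
  then have B: "B > 0" using le[of "Polynomial.degree h"] by simp
  have le': "v (poly.coeff h i) \<le> B" for i
    using le[of i] B by (cases "i \<le> Polynomial.degree h") (auto simp: coeff_eq_0)
  show ?thesis
  proof (rule that[of "poly.coeff h j" j])
    show "poly.coeff h j \<in> M" "poly.coeff h j \<noteq> 0" using h j B by auto
    show "poly.coeff (Polynomial.smult (inverse (poly.coeff h j)) h) i \<in> M" for i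
      using h Qp.inverse_in_overring[OF M] subring_UR_closed(6)[OF M(1)] by simp
    show "v (poly.coeff (Polynomial.smult (inverse (poly.coeff h j)) h) i) \<le> 1" for i
      using le'[of i] B by (simp add: v_divide j field_simps)
    show "v (poly.coeff (Polynomial.smult (inverse (poly.coeff h j)) h) j) = 1"
      using B by (simp add: val_mult v_inverse j)
  qed
qed

text \<open>Division with remainder by \<open>f\<close>; as \<open>f\<close> vanishes at
  \<open>r\<close>, the remainder has the same value there.\<close>

lemma poly_reduce_mod_monic:
  assumes M: "subring M UR"
    and f: "Polynomial.lead_coeff f = 1" "\<And>i. poly.coeff f i \<in> M" "poly f r = 0"
    and g: "\<And>i. poly.coeff g i \<in> M"
  obtains h where "\<And>i. poly.coeff h i \<in> M" "poly h r = poly g r"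
    "h = 0 \<or> Polynomial.degree h < Polynomial.degree f"
proof -
  note MD = subring_UR_closed[OF M]
  have "\<exists>h. (\<forall>i. poly.coeff h i \<in> M) \<and> poly h r = poly g r \<and>
      (h = 0 \<or> Polynomial.degree h < Polynomial.degree f)"
    using g
  proof (induction "Polynomial.degree g" arbitrary: g rule: less_induct)
    case less
    define n where "n = Polynomial.degree g"
    show ?case
    proof (cases "n < Polynomial.degree f")
      case True
      then show ?thesis using less.prems unfolding n_def by blast
    next
      case False
      define m where "m = n - Polynomial.degree f"
      define g1 where "g1 = g - Polynomial.monom (poly.coeff g n) m * f"
      have g1: "poly.coeff g1 i \<in> M" for i
        using less.prems f(2) MD by (simp add: g1_def coeff_monom_mult)
      have r: "poly g1 r = poly g r" by (simp add: g1_def f)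
      have "Polynomial.degree (Polynomial.monom (poly.coeff g n) m * f) \<le> n"
        by (rule order_trans[OF degree_mult_le])
          (use False degree_monom_le[of "poly.coeff g n" m] in \<open>simp add: m_def\<close>)
      then have "Polynomial.degree g1 \<le> n"
        unfolding g1_def by (intro degree_diff_le) (auto simp: n_def)
      moreover have "poly.coeff g1 n = 0"
        using f(1) False by (simp add: g1_def coeff_monom_mult m_def)
      ultimately have "g1 = 0 \<or> Polynomial.degree g1 < n"
        by (rule eq_zero_or_degree_less)
      then show ?thesis
      proof
        assume "g1 = 0"
        then show ?thesis using r MD(1) by (intro exI[of _ 0]) auto
      next
        assume "Polynomial.degree g1 < n"
        then show ?thesis using less.hyps[of g1] g1 r unfolding n_def by metis
      qed
    qed
  qed
  then show ?thesis using that by blast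
qed

text \<open>A monic polynomial over \<open>M\<close> lifting the minimal polynomial of the residue class of \<open>x\<close> has a
  root \<open>r\<close> close to \<open>x\<close>, and \<open>M[r]\<close> has the value group of \<open>M\<close>.\<close>
lemma residue_lift_extension:
  assumes M: "subring M UR" "Qp v \<subseteq> M" and x: "v x \<le> 1"
  obtains R r where "subring R UR" "M \<subseteq> R" "r \<in> R" "v (x - r) < 1"
    "\<And>z. z \<in> R - {0} \<Longrightarrow> v z \<in> v ` (M - {0})"
proof -
  note MD = subring_UR_closed[OF M(1)]
  \<comment> \<open>Monic integral polynomials over \<open>M\<close> whose reduction vanishes at the
    residue class of \<open>x\<close>. One of least degree lifts the minimal polynomial of that
    class.\<close>
  define P where "P f \<longleftrightarrow> Polynomial.lead_coeff f = 1 \<and> (\<forall>i. poly.coeff f i \<in> M) \<and>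
    (\<forall>i. v (poly.coeff f i) \<le> 1) \<and> v (poly f x) < 1" for f
  have "\<exists>f. P f"
  proof -
    obtain g where g: "g \<noteq> 0" "\<And>i. poly.coeff g i \<in> M" "poly g x = 0"
      using Qp.algebraic[of x] M(2) by blast
    obtain c j where c: "\<And>i. poly.coeff (Polynomial.smult (inverse c) g) i \<in> M"
      "\<And>i. v (poly.coeff (Polynomial.smult (inverse c) g) i) \<le> 1"
      "v (poly.coeff (Polynomial.smult (inverse c) g) j) = 1"
      using poly_normalize[OF M g(1,2)] by metis
    have "v (poly (Polynomial.smult (inverse c) g) x) < 1" using g by simp
    then show ?thesis using monic_of_unit_coeff[OF M x c] unfolding P_def by metis
  qed
  then obtain f where f: "P f" and min: "\<And>g. P g \<Longrightarrow> Polynomial.degree f \<le> Polynomial.degree g"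
    using ex_has_least_nat[of P _ Polynomial.degree] by metis
  obtain r where r: "poly f r = 0" "v (x - r) < 1"
    using monic_near_root f unfolding P_def by blast
  define R where "R = {poly g r | g. \<forall>i. poly.coeff g i \<in> M}"
  have RI: "poly g r \<in> R" if "\<And>i. poly.coeff g i \<in> M" for g
    using that unfolding R_def by blast
  have "a \<in> R" if "a \<in> M" for a
    using RI[of "[:a:]"] that MD by (auto simp: coeff_pCons split: nat.splits)
  then have sub: "M \<subseteq> R" by blast
  moreover have "r \<in> R"
    using RI[of "[:0, 1:]"] MD by (auto simp: coeff_pCons split: nat.splits)
  moreover have "subring R UR"
    unfolding subring_UR_iff
  proof (intro conjI ballI)
    show "1 \<in> R" using MD(2) sub by blast
    fix a assume "a \<in> R"
    then obtain g where g: "a = poly g r" "\<And>i. poly.coeff g i \<in> M" unfolding R_def by blast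
    show "- a \<in> R" using RI[of "- g"] g MD by simp
    fix b assume "b \<in> R"
    then obtain h where h: "b = poly h r" "\<And>i. poly.coeff h i \<in> M" unfolding R_def by blast
    show "a + b \<in> R" using RI[of "g + h"] g h MD by simp
    have "poly.coeff (g * h) i \<in> M" for i
      unfolding coeff_mult using g h by (intro MD)
    then show "a * b \<in> R" using RI[of "g * h"] g h by simp
  qed
  moreover have "v z \<in> v ` (M - {0})" if z: "z \<in> R - {0}" for z
  proof -
    obtain g where g: "z = poly g r" "\<And>i. poly.coeff g i \<in> M" using z unfolding R_def by blast
    obtain h where h: "\<And>i. poly.coeff h i \<in> M" "poly h r = z"
      "h = 0 \<or> Polynomial.degree h < Polynomial.degree f"
      using poly_reduce_mod_monic[OF M(1) _ _ r(1) g(2)] f g(1) unfolding P_def by metis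
    have "h \<noteq> 0" using h z by auto
    then have deg: "Polynomial.degree h < Polynomial.degree f" using h by simp
    obtain c j where c: "c \<in> M" "c \<noteq> 0" "\<And>i. poly.coeff (Polynomial.smult (inverse c) h) i \<in> M"
      "\<And>i. v (poly.coeff (Polynomial.smult (inverse c) h) i) \<le> 1"
      "v (poly.coeff (Polynomial.smult (inverse c) h) j) = 1"
      using poly_normalize[OF M \<open>h \<noteq> 0\<close> h(1)] by metis
    let ?h = "Polynomial.smult (inverse c) h"
    have "v r \<le> 1" using v_diff[of x "x - r"] x r by simp
    then have le: "v (poly ?h r) \<le> 1" using v_poly_le[OF c(4)] by blast
    \<comment> \<open>If the value at \<open>r\<close> were small, so would be the value at the
      nearby \<open>x\<close>, and making \<open>?h\<close> monic would give a member of
      \<open>P\<close> of degree below that of \<open>f\<close>. Hence every nonzero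
      \<open>z\<close> in \<open>R\<close> has the absolute value of some \<open>c\<close> in
      \<open>M\<close>.\<close>
    have "v (poly ?h r) = 1"
    proof (rule ccontr)
      assume "v (poly ?h r) \<noteq> 1"
      then have "v (poly ?h r) < 1" using le by simp
      then have "v (poly ?h x) < 1"
        using v_poly_diff_less[OF c(4) x r(2)]
          val_ultrametric[of "poly ?h x - poly ?h r" "poly ?h r"] by simp
      then obtain f' where "P f'" "Polynomial.degree f' \<le> Polynomial.degree ?h"
        using monic_of_unit_coeff[OF M x c(3-5)] unfolding P_def by metis
      then show False using min[of f'] deg \<open>c \<noteq> 0\<close> by simp
    qed
    then have "v z = v c" using h(2) v_pos[OF c(2)] by (auto simp: v_divide field_simps)
    then show ?thesis using c by auto
  qed
  ultimately show ?thesis using that r by blast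
qed

text \<open>Zorn's lemma over subrings. For integral \<open>x\<close>,
  \<open>residue_lift_extension\<close> yields a competitor containing some \<open>r\<close> close
  to \<open>x\<close>; maximality forces it to equal \<open>M\<close>, so \<open>r\<close> lies in
  \<open>M\<close>.\<close>

lemma maximal_same_value_group:
  assumes F: "subring F UR" "Qp v \<subseteq> F"
  obtains M where "subring M UR" "F \<subseteq> M" "\<And>z. z \<in> M - {0} \<Longrightarrow> v z \<in> v ` (F - {0})"
    "\<And>x. v x \<le> 1 \<Longrightarrow> \<exists>m\<in>M. v (x - m) < 1"
proof -
  define A where "A = {M. subring M UR \<and> F \<subseteq> M \<and> v ` (M - {0}) \<subseteq> v ` (F - {0})}"
  have "\<exists>M\<in>A. \<forall>H\<in>A. M \<subseteq> H \<longrightarrow> H = M"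
  proof (rule subset_Zorn_nonempty)
    show "A \<noteq> {}" using F by (auto simp: A_def)
  next
    fix C assume C: "C \<noteq> {}" "subset.chain A C"
    then have CA: "subring M UR" "F \<subseteq> M" "v ` (M - {0}) \<subseteq> v ` (F - {0})" if "M \<in> C" for M
    proof -
      have "M \<in> A" using that C(2) by (auto simp: subset.chain_def)
      then show "subring M UR" "F \<subseteq> M" "v ` (M - {0}) \<subseteq> v ` (F - {0})" by (simp_all add: A_def)
    qed
    have "subring (\<Union>C) UR"
      unfolding subring_UR_iff
    proof (intro conjI ballI)
      show "1 \<in> \<Union>C" using C(1) CA(1) subring_UR_closed(2) by blast
      fix a assume "a \<in> \<Union>C"
      then obtain M where M: "M \<in> C" "a \<in> M" by blast
      show "- a \<in> \<Union>C" using M CA(1)[OF M(1)] subring_UR_closed(3) by blast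
      fix b assume "b \<in> \<Union>C"
      then obtain M' where M': "M' \<in> C" "b \<in> M'" by blast
      have "M \<subseteq> M' \<or> M' \<subseteq> M" using C(2) M(1) M'(1) by (auto simp: subset.chain_def)
      then obtain H where "H \<in> C" "a \<in> H" "b \<in> H" using M M' by blast
      then show "a + b \<in> \<Union>C" "a * b \<in> \<Union>C"
        using CA(1) subring_UR_closed(4,6) by blast+
    qed
    moreover have "F \<subseteq> \<Union>C" using C(1) CA(2) by blast
    moreover have "v ` (\<Union>C - {0}) \<subseteq> v ` (F - {0})" using CA(3) by blast
    ultimately show "\<Union>C \<in> A" by (simp add: A_def)
  qed
  then obtain M where M: "M \<in> A" and max: "\<And>H. H \<in> A \<Longrightarrow> M \<subseteq> H \<Longrightarrow> H = M" by blast
  have M': "subring M UR" "F \<subseteq> M" "v ` (M - {0}) \<subseteq> v ` (F - {0})" using M by (auto simp: A_def)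
  show ?thesis
  proof (rule that[OF M'(1,2)])
    show "v z \<in> v ` (F - {0})" if "z \<in> M - {0}" for z using M'(3) that by blast
    fix x assume "v x \<le> 1"
    then obtain R r where R: "subring R UR" "M \<subseteq> R" "r \<in> R" "v (x - r) < 1"
      "\<And>z. z \<in> R - {0} \<Longrightarrow> v z \<in> v ` (M - {0})"
      using residue_lift_extension[OF M'(1) order_trans[OF F(2) M'(2)]] by metis
    have "v ` (R - {0}) \<subseteq> v ` (F - {0})" using R(5) M'(3) by blast
    then have "R \<in> A" using R(1,2) M'(2) by (auto simp: A_def)
    then have "R = M" using max R(2) by blast
    then show "\<exists>m\<in>M. v (x - m) < 1" using R by blast
  qed
qed

section \<open>Inertia elements that do not fix a ramified extension\<close>

lemma inertia_moving:
  assumes F: "subring F UR" "Qp v \<subseteq> F" and x: "x \<noteq> 0" "v x \<notin> v ` (F - {0})"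
  obtains g where "g \<in> inertia v F" "g x \<noteq> x"
proof -
  obtain M where M: "subring M UR" "F \<subseteq> M" "\<And>z. z \<in> M - {0} \<Longrightarrow> v z \<in> v ` (F - {0})"
    "\<And>x. v x \<le> 1 \<Longrightarrow> \<exists>m\<in>M. v (x - m) < 1"
    using maximal_same_value_group[OF F] by metis
  have QM: "Qp v \<subseteq> M" using F M by blast
  have "x \<notin> M" using M(3)[of x] x by auto
  then obtain g where g: "g \<in> ring_iso UR UR" "\<And>a. a \<in> M \<Longrightarrow> g a = a" "g x \<noteq> x"
    using Qp.automorphism_moving[OF M(1) QM] by metis
  have hom: "g (a + b) = g a + g b" for a b
    using g(1) by (auto simp: ring_iso_def ring_hom_def)
  have iso: "v (g y) = v y" for y
    using val_ring_hom_invariant[OF g(1)] g(2) QM by blast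
  have "v (g y - y) < 1" if y: "v y \<le> 1" for y
  proof -
    obtain m where m: "m \<in> M" "v (y - m) < 1" using M(4) y by blast
    \<comment> \<open>The representative \<open>m\<close> of the residue class of \<open>y\<close>
      is fixed and cancels; both remaining terms have the absolute value of
      \<open>y - m\<close>.\<close>
    have "g y = g (y - m) + m" using hom[of "y - m" m] g(2)[OF m(1)] by simp
    then have *: "g y - y = g (y - m) - (y - m)" by simp
    have "v (g y - y) \<le> v (y - m)" unfolding * using v_diff[of "g (y - m)" "y - m"] unfolding iso by simp
    then show ?thesis using m(2) by simp
  qed
  then have "g \<in> inertia v F"
    using g M(2) by (auto simp: inertia_def Gal_def)
  then show ?thesis using g(3) that by blast
qed

text \<open>If every nonzero element of \<open>E\<close> had its absolute value attained on
  \<open>F\<close>, all cosets would equal the value group of \<open>F\<close>, and the ramification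
  index would be at most 1.\<close>

lemma ramified_value_exists:
  assumes F: "subfield F UR" and ram: "ramified v F E"
  obtains x where "x \<in> E" "x \<noteq> 0" "v x \<notin> v ` (F - {0})"
proof -
  note FD = subring_UR_closed[OF subfieldE(1)[OF F]]
  let ?H = "v ` (F - {0})"
  have H_mult: "s * t \<in> ?H" if st: "s \<in> ?H" "t \<in> ?H" for s t
  proof -
    obtain a b where "s = v a" "t = v b" "a \<in> F - {0}" "b \<in> F - {0}" using st by blast
    then have "s * t = v (a * b)" "a * b \<in> F - {0}" using FD(6) by (auto simp: val_mult)
    then show ?thesis by blast
  qed
  have H_inv: "inverse s \<in> ?H" if s: "s \<in> ?H" for s
  proof -
    obtain a where "s = v a" "a \<in> F - {0}" using s by blast
    then have "inverse s = v (inverse a)" "inverse a \<in> F - {0}"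
      using subfield_UR_inverse[OF F] by (auto simp: v_inverse)
    then show ?thesis by blast
  qed
  have H_nz: "s \<noteq> 0" if "s \<in> ?H" for s using that by (auto simp: val_eq_0_iff)
  have "\<exists>x\<in>E - {0}. v x \<notin> ?H"
  proof (rule ccontr)
    assume "\<not> ?thesis"
    then have sub: "v ` (E - {0}) \<subseteq> ?H" by blast
    have coset: "(\<lambda>h. h * s) ` ?H = ?H" if s: "s \<in> ?H" for s
    proof
      show "(\<lambda>h. h * s) ` ?H \<subseteq> ?H" using H_mult s by blast
      have "h = (h * inverse s) * s" for h using H_nz[OF s] by simp
      then show "?H \<subseteq> (\<lambda>h. h * s) ` ?H" using H_mult H_inv[OF s] by blast
    qed
    have "rcosets\<^bsub>value_group v E\<^esub> (carrier (value_group v F)) =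
      (\<lambda>s. (\<lambda>h. h * s) ` ?H) ` v ` (E - {0})"
      by (auto simp: RCOSETS_def r_coset_def value_group_def)
    also have "\<dots> \<subseteq> {?H}" using coset sub by blast
    finally have "card (rcosets\<^bsub>value_group v E\<^esub> (carrier (value_group v F))) \<le> card {?H}"
      by (intro card_mono) simp_all
    then show False using ram by (simp add: ramified_def ramification_index_def)
  qed
  then show ?thesis using that by blast
qed

end

section \<open>Traces of intertwined matrices\<close>

lemma mat2_simps:
  "A \<in> carrier (mat2 R) \<longleftrightarrow> (\<forall>i j. A $ i $ j \<in> carrier R)"
  "(A \<otimes>\<^bsub>mat2 R\<^esub> B) $ i $ j = A $ i $ 1 \<otimes>\<^bsub>R\<^esub> B $ 1 $ j \<oplus>\<^bsub>R\<^esub> A $ i $ 2 \<otimes>\<^bsub>R\<^esub> B $ 2 $ j"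
  "\<one>\<^bsub>mat2 R\<^esub> $ i $ j = (if i = j then \<one>\<^bsub>R\<^esub> else \<zero>\<^bsub>R\<^esub>)"
  by (simp_all add: mat2_def)

lemma (in cring) monoid_mat2: "monoid (mat2 R)"
proof
  fix A B C assume "A \<in> carrier (mat2 R)" "B \<in> carrier (mat2 R)" "C \<in> carrier (mat2 R)"
  then show "A \<otimes>\<^bsub>mat2 R\<^esub> B \<otimes>\<^bsub>mat2 R\<^esub> C = A \<otimes>\<^bsub>mat2 R\<^esub> (B \<otimes>\<^bsub>mat2 R\<^esub> C)"
    by (simp add: vec_eq_iff mat2_simps l_distr r_distr m_assoc a_ac)
qed (auto simp: mat2_simps vec_eq_iff forall_2)

text \<open>Taken with the operations of \<open>R\<close>, because it is needed in the field, in its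
  valuation ring and in the residue field, whose elements are cosets.\<close>

definition trace2 :: "('c, 'm) ring_scheme \<Rightarrow> 'c^2^2 \<Rightarrow> 'c" where
  "trace2 R A = A $ 1 $ 1 \<oplus>\<^bsub>R\<^esub> A $ 2 $ 2"

context cring
begin

lemma trace2_mult_commute:
  assumes "A \<in> carrier (mat2 R)" "B \<in> carrier (mat2 R)"
  shows "trace2 R (A \<otimes>\<^bsub>mat2 R\<^esub> B) = trace2 R (B \<otimes>\<^bsub>mat2 R\<^esub> A)"
  using assms by (simp add: trace2_def mat2_simps m_comm a_ac)

text \<open>With \<open>P\<close> invertible, \<open>A\<close> is the conjugate of \<open>B\<close>
  by the inverse of \<open>P\<close>, and traces are invariant under cyclic permutation of
  factors.\<close>

lemma trace2_intertwined:
  assumes P: "P \<in> Units (mat2 R)" and A: "A \<in> carrier (mat2 R)" and B: "B \<in> carrier (mat2 R)"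
    and eq: "P \<otimes>\<^bsub>mat2 R\<^esub> A = B \<otimes>\<^bsub>mat2 R\<^esub> P"
  shows "trace2 R A = trace2 R B"
proof -
  interpret m: monoid "mat2 R" by (rule monoid_mat2)
  let ?Q = "inv\<^bsub>mat2 R\<^esub> P"
  have P': "P \<in> carrier (mat2 R)" "?Q \<in> carrier (mat2 R)" using P by auto
  have "A = ?Q \<otimes>\<^bsub>mat2 R\<^esub> (B \<otimes>\<^bsub>mat2 R\<^esub> P)"
    using P P' A by (simp add: eq[symmetric] m.m_assoc[symmetric])
  then have "trace2 R A = trace2 R ((B \<otimes>\<^bsub>mat2 R\<^esub> P) \<otimes>\<^bsub>mat2 R\<^esub> ?Q)"
    using trace2_mult_commute P' B by simp
  also have "(B \<otimes>\<^bsub>mat2 R\<^esub> P) \<otimes>\<^bsub>mat2 R\<^esub> ?Q = B"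
    using P P' B by (simp add: m.m_assoc)
  finally show ?thesis .
qed

end

section \<open>Passing between a field and its subrings\<close>

lemma mat2_UR_update:
  "(\<otimes>\<^bsub>mat2 (UR\<lparr>carrier := S\<rparr>)\<^esub>) = (\<otimes>\<^bsub>mat2 (UR :: 'c::field ring)\<^esub>)"
  "\<one>\<^bsub>mat2 (UR\<lparr>carrier := S\<rparr>)\<^esub> = \<one>\<^bsub>mat2 (UR :: 'c::field ring)\<^esub>"
  by (simp_all add: mat2_def cong: if_cong)

lemma Units_mat2_UR_update:
  "Units (mat2 (UR\<lparr>carrier := S\<rparr>)) \<subseteq> Units (mat2 (UR :: 'c::field ring))"
  unfolding Units_def mat2_UR_update by (auto simp: mat2_simps)

text \<open>The additive inverse is a description over the carrier, so it has to be recomputed when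
  the carrier shrinks.\<close>

lemma UR_update_a_inv:
  assumes "subring S (UR :: 'c::field ring)" "x \<in> S"
  shows "\<ominus>\<^bsub>UR\<lparr>carrier := S\<rparr>\<^esub> x = - x"
proof -
  interpret ring "UR :: 'c ring" by (rule ring_from_type_algebra)
  interpret S: ring "UR\<lparr>carrier := S\<rparr>" using assms(1) by (rule subring_is_ring)
  show ?thesis using S.minus_equality[of "- x" x] assms subring_UR_closed(3)[OF assms(1)] by simp
qed

context padic_closure
begin

section \<open>Reduction modulo the maximal ideal\<close>

lemma valuation_subring:
  assumes "subring K UR"
  shows "subring {x \<in> K. v x \<le> 1} UR"
  unfolding subring_UR_iff
  using subring_UR_closed[OF assms]
  by (auto simp: val_mult mult_le_one val_nonneg intro: order_trans[OF val_ultrametric])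

lemma cring_valuation_ring:
  assumes "subring K UR"
  shows "cring (valuation_ring v K)"
proof -
  interpret cring "UR :: 'a ring" by (rule cring_from_type_algebra)
  show ?thesis
    unfolding valuation_ring_def
    using subcringI'[OF valuation_subring[OF assms]] by (subst subcring_iff[symmetric]) simp_all
qed

lemma ideal_maximal_ideal:
  assumes K: "subring K UR"
  shows "ideal (maximal_ideal v K) (valuation_ring v K)"
proof (rule idealI)
  interpret V: cring "valuation_ring v K" by (rule cring_valuation_ring[OF K])
  note KD = subring_UR_closed[OF K]
  have simps: "carrier (valuation_ring v K) = {x \<in> K. v x \<le> 1}"
    "(\<otimes>\<^bsub>valuation_ring v K\<^esub>) = (*)" "(\<oplus>\<^bsub>valuation_ring v K\<^esub>) = (+)"
    "\<zero>\<^bsub>valuation_ring v K\<^esub> = 0"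
    by (auto simp: valuation_ring_def fun_eq_iff)
  have minus: "\<ominus>\<^bsub>valuation_ring v K\<^esub> x = - x" if "x \<in> maximal_ideal v K" for x
    using UR_update_a_inv[OF valuation_subring[OF K], of x] that
    by (simp add: valuation_ring_def maximal_ideal_def)
  show "ring (valuation_ring v K)" by (rule V.ring_axioms)
  show "subgroup (maximal_ideal v K) (add_monoid (valuation_ring v K))"
  proof
    show "inv\<^bsub>add_monoid (valuation_ring v K)\<^esub> x \<in> maximal_ideal v K"
      if "x \<in> maximal_ideal v K" for x
      using minus[OF that] that KD by (simp add: a_inv_def maximal_ideal_def)
    show "x \<otimes>\<^bsub>add_monoid (valuation_ring v K)\<^esub> y \<in> maximal_ideal v K"
      if "x \<in> maximal_ideal v K" "y \<in> maximal_ideal v K" for x y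
      using that KD by (auto simp: maximal_ideal_def simps intro: le_less_trans[OF val_ultrametric])
  qed (use KD in \<open>auto simp: maximal_ideal_def simps\<close>)
  fix a x assume "a \<in> maximal_ideal v K" "x \<in> carrier (valuation_ring v K)"
  then have "a * x \<in> maximal_ideal v K"
    using mult_left_mono[of "v x" 1 "v a"] val_nonneg[of a] KD
    by (simp add: maximal_ideal_def simps val_mult)
  then show "a \<otimes>\<^bsub>valuation_ring v K\<^esub> x \<in> maximal_ideal v K"
    "x \<otimes>\<^bsub>valuation_ring v K\<^esub> a \<in> maximal_ideal v K"
    by (simp_all add: simps mult.commute)
qed

lemma v_two:
  assumes "odd p"
  shows "v 2 = 1"
proof -
  have "\<not> p dvd 2" using assms primes_dvd_imp_eq[OF prime_p two_is_prime_nat] by auto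
  then have "\<not> int p dvd 2" by (metis int_dvd_int_iff of_nat_numeral)
  then show ?thesis using val_of_int[of 2] by (simp add: not_dvd_imp_multiplicity_0)
qed

text \<open>Reduction is a ring homomorphism, so it commutes with the trace. Over the residue field
  the intertwined traces agree, that is, the original traces differ by an element of the maximal
  ideal.\<close>

lemma reduction_trace_cong:
  assumes K: "subring K UR"
    and iso: "rep_iso G (residue_field v K) (reduction v K \<rho>1) (reduction v K \<rho>2)"
    and g: "g \<in> carrier G"
    and "\<rho>1 g \<in> carrier (mat2 (valuation_ring v K))" "\<rho>2 g \<in> carrier (mat2 (valuation_ring v K))"
  shows "v (trace2 UR (\<rho>1 g) - trace2 UR (\<rho>2 g)) < 1"
proof -
  let ?V = "valuation_ring v K" and ?I = "maximal_ideal v K"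
  interpret V: cring ?V by (rule cring_valuation_ring[OF K])
  interpret I: ideal ?I ?V by (rule ideal_maximal_ideal[OF K])
  interpret k: cring "residue_field v K"
    unfolding residue_field_def by (rule I.quotient_is_cring[OF V.is_cring])
  note hom = I.rcos_ring_hom[folded residue_field_def]
  have red: "reduction v K \<rho> g \<in> carrier (mat2 (residue_field v K)) \<and>
      trace2 (residue_field v K) (reduction v K \<rho> g) = ?I +>\<^bsub>?V\<^esub> trace2 ?V (\<rho> g) \<and>
      trace2 ?V (\<rho> g) \<in> carrier ?V"
    if "\<rho> g \<in> carrier (mat2 ?V)" for \<rho>
    using that ring_hom_closed[OF hom] ring_hom_add[OF hom]
    by (simp add: mat2_simps reduction_def trace2_def)
  obtain P where P: "P \<in> Units (mat2 (residue_field v K))"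
    "P \<otimes>\<^bsub>mat2 (residue_field v K)\<^esub> reduction v K \<rho>1 g =
      reduction v K \<rho>2 g \<otimes>\<^bsub>mat2 (residue_field v K)\<^esub> P"
    using iso g by (auto simp: rep_iso_def units_of_carrier)
  have "?I +>\<^bsub>?V\<^esub> trace2 ?V (\<rho>1 g) = ?I +>\<^bsub>?V\<^esub> trace2 ?V (\<rho>2 g)"
    using k.trace2_intertwined[OF P(1) _ _ P(2)] red assms(4,5) by metis
  then have *: "trace2 ?V (\<rho>1 g) \<ominus>\<^bsub>?V\<^esub> trace2 ?V (\<rho>2 g) \<in> ?I"
    using V.quotient_eq_iff_same_a_r_cos[OF I.ideal_axioms] red assms(4,5) by metis
  have "trace2 ?V A = trace2 UR A" for A by (simp add: trace2_def valuation_ring_def)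
  moreover have "x \<ominus>\<^bsub>?V\<^esub> y = x - y" if "y \<in> carrier ?V" for x y
    using UR_update_a_inv[OF valuation_subring[OF K], of y] that
    by (simp add: a_minus_def valuation_ring_def)
  ultimately have "trace2 UR (\<rho>1 g) - trace2 UR (\<rho>2 g) \<in> ?I"
    using * red assms(5) by metis
  then show ?thesis by (simp add: maximal_ideal_def)
qed

end

text \<open>Outside the Weil group of \<open>E\<close> the induced matrix is antidiagonal, and
  conjugation by \<open>U\<close> keeps the trace.\<close>

lemma trace2_Ind_conjugate:
  fixes \<xi> :: "('a::field \<Rightarrow> 'a) \<Rightarrow> 'b::field"
  assumes U: "U \<in> carrier (GL2 (UR\<lparr>carrier := K\<rparr>))" and g: "g \<notin> carrier (Weil_group v E)"
  shows "trace2 UR (U \<otimes>\<^bsub>GL2 UR\<^esub> Ind v F E \<sigma> \<xi> g \<otimes>\<^bsub>GL2 UR\<^esub> inv\<^bsub>GL2 UR\<^esub> U) = 0"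
proof -
  interpret cring "UR :: 'b ring" by (rule cring_from_type_algebra)
  interpret m: monoid "mat2 (UR :: 'b ring)" by (rule monoid_mat2)
  let ?M = "Ind v F E \<sigma> \<xi> g"
  have U': "U \<in> Units (mat2 UR)"
    using U Units_mat2_UR_update by (auto simp: units_of_carrier)
  have M: "?M \<in> carrier (mat2 UR)" by (simp add: mat2_simps)
  have Uc: "U \<in> carrier (mat2 UR)" "inv\<^bsub>mat2 UR\<^esub> U \<in> carrier (mat2 UR)" using U' by auto
  have "trace2 UR (U \<otimes>\<^bsub>mat2 UR\<^esub> ?M \<otimes>\<^bsub>mat2 UR\<^esub> inv\<^bsub>mat2 UR\<^esub> U) = trace2 UR ?M"
    using U' Uc M by (intro trace2_intertwined[symmetric, OF U']) (auto simp: m.m_assoc)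
  also have "\<dots> = 0" using g by (simp add: Ind_def trace2_def Let_def)
  finally show ?thesis using m.units_of_inv[OF U'] by (simp add: units_of_mult)
qed

theorem proposition3p6:
  fixes p l :: nat
    and v :: "'a::field_char_0 \<Rightarrow> real" and w :: "'b::field_char_0 \<Rightarrow> real"
    and F E :: "'a set" and K :: "'b set"
    and \<Phi> \<sigma> :: "'a \<Rightarrow> 'a"
    and \<omega> t \<xi> chi :: "('a \<Rightarrow> 'a) \<Rightarrow> 'b"
    and \<rho>1 \<rho>2 :: "('a \<Rightarrow> 'a) \<Rightarrow> 'b^2^2"
    and a1 b1 d1 a2 b2 d2 :: 'b
  assumes "odd p" and "odd l" and "p \<noteq> l"
    and "padic_closure p v" and "padic_closure l w"
    and "finite_ext (Qp v) F" and "finite_ext (Qp w) K"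
    and "Frobenius_element v F \<Phi>" and "is_omega v F \<Phi> \<omega>" and "tame_hom v F w t"
    and "supercuspidal_with v F \<Phi> w t E \<sigma> \<xi> \<rho>1"
    and "special_with v F \<Phi> \<omega> w t chi \<rho>2"
    and "\<rho>1 ` carrier (Weil_group v F) \<subseteq> carrier (GL2 (valuation_ring w K))"
    and "\<rho>2 ` carrier (Weil_group v F) \<subseteq> carrier (GL2 (valuation_ring w K))"
    and "mtx a1 b1 0 d1 \<in> carrier (GL2 (UR\<lparr>carrier := K\<rparr>))"
    and "mtx a2 b2 0 d2 \<in> carrier (GL2 (UR\<lparr>carrier := K\<rparr>))"
    and "\<And>(k::int) \<tau> g. \<tau> \<in> inertia v F \<Longrightarrow>
           g = \<Phi> [^]\<^bsub>Weil_group v F\<^esub> k \<otimes>\<^bsub>Weil_group v F\<^esub> \<tau> \<Longrightarrow>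
           \<rho>1 g = mtx a1 b1 0 d1 \<otimes>\<^bsub>GL2 UR\<^esub> Ind v F E \<sigma> \<xi> g \<otimes>\<^bsub>GL2 UR\<^esub> inv\<^bsub>GL2 UR\<^esub> (mtx a1 b1 0 d1)"
    and "\<And>(k::int) \<tau> g. \<tau> \<in> inertia v F \<Longrightarrow>
           g = \<Phi> [^]\<^bsub>Weil_group v F\<^esub> k \<otimes>\<^bsub>Weil_group v F\<^esub> \<tau> \<Longrightarrow>
           \<rho>2 g = mtx (chi g * \<omega> g)
                      (a2 / d2 * t \<tau> * (chi g * \<omega> g) + b2 / d2 * (chi g - chi g * \<omega> g))
                      0 (chi g)"
    and "a2 / d2 \<in> Units (valuation_ring w K)"
    and "ramified v F E"
  shows "\<not> rep_iso (Weil_group v F) (residue_field w K) (reduction w K \<rho>1) (reduction w K \<rho>2)"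
proof
  assume iso: "rep_iso (Weil_group v F) (residue_field w K) (reduction w K \<rho>1) (reduction w K \<rho>2)"
  interpret v: padic_closure p v by fact
  interpret w: padic_closure l w by fact
  have F: "subfield F UR" "Qp v \<subseteq> F" and K: "subring K UR"
    using assms(6,7) by (auto simp: finite_ext_def subfieldE)
  obtain x where x: "x \<in> E" "x \<noteq> 0" "v x \<notin> v ` (F - {0})"
    using v.ramified_value_exists[OF F(1) \<open>ramified v F E\<close>] by blast
  obtain g where g: "g \<in> inertia v F" "g x \<noteq> x"
    using v.inertia_moving[OF subfieldE(1)[OF F(1)] F(2) x(2,3)] by blast
  \<comment> \<open>Inertia is the case \<open>n = 0\<close> of the Weil condition, the exponent
    \<open>q ^ 0\<close> being 1.\<close>
  have gW: "g \<in> carrier (Weil_group v F)"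
    using g(1) by (auto simp: inertia_def Weil_group_def intro!: exI[of _ 0])
  \<comment> \<open>Elements of the Weil group of \<open>E\<close> fix \<open>E\<close> pointwise,
    but \<open>g\<close> moves \<open>x\<close>.\<close>
  have gE: "g \<notin> carrier (Weil_group v E)"
    using g(2) x(1) by (auto simp: Weil_group_def Gal_def)
  \<comment> \<open>Power 0 of Frobenius: the explicit formulas apply with
    \<open>\<tau> = g\<close>, and \<open>\<omega> g = 1\<close>.\<close>
  have g_eq: "g = \<Phi> [^]\<^bsub>Weil_group v F\<^esub> (0::int) \<otimes>\<^bsub>Weil_group v F\<^esub> g"
    by (simp add: Weil_group_def)
  have "\<omega> g = 1"
    using assms(9) g(1) g_eq unfolding is_omega_def by (metis minus_zero power_int_0_right)
  then have tr2: "trace2 UR (\<rho>2 g) = 2 * chi g" and \<rho>2: "\<rho>2 g $ 2 $ 1 = 0" "\<rho>2 g $ 2 $ 2 = chi g"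
    using assms(18)[OF g(1) g_eq] by (simp_all add: trace2_def)
  have tr1: "trace2 UR (\<rho>1 g) = 0"
    unfolding assms(17)[OF g(1) g_eq] by (rule trace2_Ind_conjugate[OF assms(15) gE])
  have units: "\<rho>1 g \<in> Units (mat2 (valuation_ring w K))" "\<rho>2 g \<in> Units (mat2 (valuation_ring w K))"
    using assms(13,14) gW by (auto simp: units_of_carrier)
  have "w (2 * chi g) < 1"
    using w.reduction_trace_cong[OF K iso gW] units tr1 tr2 by (auto simp: Units_def)
  then have "w (chi g) < 1" by (simp add: w.val_mult w.v_two[OF \<open>odd l\<close>])
  \<comment> \<open>An integral right inverse of \<open>\<rho>2 g\<close> shows that
    \<open>chi g\<close> is a unit: since the lower left entry of \<open>\<rho>2 g\<close> is 0, the
    lower right entry of the product is \<open>chi g * B $ 2 $ 2\<close>.\<close>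
  moreover obtain B where B: "B \<in> carrier (mat2 (valuation_ring w K))"
    "\<rho>2 g \<otimes>\<^bsub>mat2 (valuation_ring w K)\<^esub> B = \<one>\<^bsub>mat2 (valuation_ring w K)\<^esub>"
    using units(2) by (auto simp: Units_def)
  have "(\<rho>2 g \<otimes>\<^bsub>mat2 (valuation_ring w K)\<^esub> B) $ 2 $ 2 = 1"
    unfolding B(2) by (simp add: mat2_simps valuation_ring_def)
  then have "chi g * B $ 2 $ 2 = 1"
    by (simp add: mat2_simps valuation_ring_def \<rho>2)
  then have "w (chi g) * w (B $ 2 $ 2) = 1" by (simp add: w.val_mult[symmetric])
  moreover have "w (B $ 2 $ 2) \<le> 1" using B(1) by (simp add: mat2_simps valuation_ring_def)
  ultimately show False
    using mult_left_mono[of "w (B $ 2 $ 2)" 1 "w (chi g)"] w.val_nonneg[of "chi g"] by simp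
qed

end
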